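(* Let $p\colon\mathbb{T}^k\to\mathbb{R}$ be a $C^{k+1}$ function and let $i\leq j$ be such that $|B_i|<\lambda$. Then either all the Fourier coefficients $(g_i)_\sigma$ of $g_i$ are zero, $\phi_i$ is $C^1$, and $\dim(\mathrm{graph}(\phi_i))=1$; or there is at least one non-zero Fourier coefficient $(g_i)_\sigma$ of $g_i$ and $$\dim(\mathrm{graph}(\phi_i))=2-\frac{\ln\lambda}{\ln|B_i|}.$$
   Context: Let $k>2$ and let $A$ be an Anosov (hyperbolic linear) automorphism of $\mathbb{T}^k=\mathbb{R}^k/\mathbb{Z}^k$ with $k$ distinct real eigenvalues satisfying $|B_1|<|B_2|<\cdots<|B_j|<1<|B_{j+1}|<\cdots<|B_k|$, whose respective eigenvectors $v_1,\dots,v_k$ form a basis of $\mathbb{R}^k$. Let $0<\lambda<1$; the skew product under consideration is $F(x,y)=(Ax,\lambda y+p(x))$ on $\mathbb{T}^k\times\mathbb{R}$. Fix a base point $\underline{t}\in\mathbb{T}^k$. For $t\in\mathbb{R}$ put $q_i(t)=p(tv_i+\underline{t})$ and $\phi_i(t)=\sum_{n=0}^\infty\lambda^n q_i(B_i^{-n}t)$. The symbol $\mathrm{graph}(\phi_i)$ denotes the graph of the restriction of $\phi_i$ to $[-\delta,\delta]$, for a fixed $\delta>0$. Fourier coefficients: for $a\in\mathbb{R}$, $(q_i)_a=\lim_{T\to\infty}\frac{1}{2T}\int_{-T}^{T}q_i(t)e^{-\mathrm{i}at}\,dt$. The Fourier coefficients of the formal series $g_i(t)=\sum_{n=-\infty}^{\infty}\lambda^n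 q_i(B_i^{-n}t)$ are defined, for $\sigma\in\mathbb{R}\setminus\{0\}$, by $$(g_i)_\sigma:=\sum_{n=-\infty}^{\infty}\lambda^n (q_i)_{\sigma B_i^{n}} .$$ $\dim$ denotes box dimension: if $N_\delta(X)$ is the smallest number of sets of diameter at most $\delta$ covering a totally bounded set $X$, then $\dim(X)=\lim_{\delta\to0^+}\frac{\log N_\delta(X)}{-\log\delta}$ when the limit exists. *)

theory Defs
  imports "HOL-Analysis.Analysis"
begin

text \<open>Functions on the torus \<open>R^k / Z^k\<close> are represented by their \<open>Z^k\<close>-periodic lifts
  to \<open>R^k\<close>, with \<open>k = CARD('k)\<close>.\<close>

definition torus_fun :: "(real^'k \<Rightarrow> 'b) \<Rightarrow> bool" where
  "torus_fun p \<longleftrightarrow> (\<forall>x m. (\<forall>i. m $ i \<in> \<int>) \<longrightarrow> p (x + m) = p x)"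

text \<open>Class \<open>C^m\<close> on the whole space: all iterated directional derivatives up to order \<open>m\<close>
  exist and are continuous.\<close>

primrec Ck_fun :: "nat \<Rightarrow> ('a::euclidean_space \<Rightarrow> 'b::real_normed_vector) \<Rightarrow> bool" where
  "Ck_fun 0 f \<longleftrightarrow> continuous_on UNIV f"
| "Ck_fun (Suc m) f \<longleftrightarrow> f differentiable_on UNIV \<and>
     (\<forall>u. Ck_fun m (\<lambda>x. frechet_derivative f (at x) u))"

text \<open>A matrix induces an automorphism of \<open>R^k / Z^k\<close> iff it is integral with determinant
  \<open>1\<close> or \<open>-1\<close>; the automorphism is Anosov iff no complex eigenvalue has modulus one.\<close>

definition anosov_automorphism :: "real^'k^'k \<Rightarrow> bool" where
  "anosov_automorphism A \<longleftrightarrow> (\<forall>r c. A $ r $ c \<in> \<int>) \<and> \<bar>det A\<bar> = 1 \<and>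
     \<not> (\<exists>z w. cmod z = 1 \<and> w \<noteq> 0 \<and> map_matrix complex_of_real A *v w = z *s w)"

text \<open>Eigenvalues and eigenvectors are indexed by \<open>1, \<dots>, CARD('k)\<close>.\<close>

definition real_eigendata ::
    "real^'k^'k \<Rightarrow> nat \<Rightarrow> (nat \<Rightarrow> real) \<Rightarrow> (nat \<Rightarrow> real^'k) \<Rightarrow> bool" where
  "real_eigendata A j B v \<longleftrightarrow>
     1 \<le> j \<and> j < CARD('k) \<and>
     strict_mono_on {1..CARD('k)} (\<lambda>i. \<bar>B i\<bar>) \<and>
     \<bar>B j\<bar> < 1 \<and> 1 < \<bar>B (Suc j)\<bar> \<and>
     (\<forall>i\<in>{1..CARD('k)}. v i \<noteq> 0 \<and> A *v v i = B i *s v i) \<and>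
     independent (v ` {1..CARD('k)}) \<and> span (v ` {1..CARD('k)}) = UNIV"

definition line_fun :: "(real^'k \<Rightarrow> real) \<Rightarrow> real^'k \<Rightarrow> real^'k \<Rightarrow> real \<Rightarrow> real" where
  "line_fun p x0 u t = p (t *\<^sub>R u + x0)"

definition phi_series :: "real \<Rightarrow> real \<Rightarrow> (real \<Rightarrow> real) \<Rightarrow> real \<Rightarrow> real" where
  "phi_series lam b q t = (\<Sum>n. lam ^ n * q (b powi (- int n) * t))"

definition fourier_coeff :: "(real \<Rightarrow> real) \<Rightarrow> real \<Rightarrow> complex" where
  "fourier_coeff q a = Lim at_top (\<lambda>T. complex_of_real (1 / (2 * T)) *
     integral {-T..T} (\<lambda>t. complex_of_real (q t) * exp (- (\<i> * complex_of_real (a * t)))))"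

text \<open>The Fourier coefficients (for nonzero \<open>s\<close>) of the formal two-sided series
  \<open>\<Sum>n. lam^n q(b^(-n) t)\<close>, where \<open>n\<close> ranges over all integers.\<close>

definition g_fourier_coeff :: "real \<Rightarrow> real \<Rightarrow> (real \<Rightarrow> real) \<Rightarrow> real \<Rightarrow> complex" where
  "g_fourier_coeff lam b q s =
     (\<Sum>\<^sub>\<infinity>n\<in>(UNIV :: int set). complex_of_real (lam powi n) * fourier_coeff q (s * b powi n))"

text \<open>Boundedness is required explicitly because \<^const>\<open>diameter\<close> carries no information
  for unbounded sets.\<close>

definition covering_number :: "'a::metric_space set \<Rightarrow> real \<Rightarrow> nat" where
  "covering_number X e = (LEAST N. \<exists>C. finite C \<and> card C = N \<and> X \<subseteq> \<Union>C \<and>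
     (\<forall>U\<in>C. bounded U \<and> diameter U \<le> e))"

text \<open>A relation rather than a function: it asserts that the limit exists.\<close>

definition has_box_dim :: "'a::metric_space set \<Rightarrow> real \<Rightarrow> bool" where
  "has_box_dim X d \<longleftrightarrow> totally_bounded X \<and>
     ((\<lambda>e. ln (real (covering_number X e)) / (- ln e)) \<longlongrightarrow> d) (at_right 0)"

definition graph_on :: "real set \<Rightarrow> (real \<Rightarrow> real) \<Rightarrow> (real \<times> real) set" where
  "graph_on S f = (\<lambda>t. (t, f t)) ` S"

end

theory Submission
  imports Defs
begin

text \<open>
  Write \<open>b\<close> for the eigenvalue \<open>B i\<close>, so that \<open>0 < \<bar>b\<bar> < lam < 1\<close>, and put
  \<open>\<alpha> = ln lam / ln \<bar>b\<bar>\<close>, which lies strictly between \<open>0\<close> and \<open>1\<close>. The formal two-sided series of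
  the statement becomes convergent when its value at the origin is subtracted termwise:
  \<open>g(t) = \<Sum>n\<in>\<int>. lam^n (q(b^(-n) t) - q(0))\<close>. The terms with \<open>n \<ge> 0\<close> are dominated by a geometric
  series because \<open>q\<close> is bounded; those with \<open>n < 0\<close> are dominated by multiples of
  \<open>(\<bar>b\<bar> / lam)^(-n)\<close> because \<open>q'\<close> is bounded, and so are their derivatives. Hence
  \<open>\<phi> = \<phi>(0) + g - \<psi>\<close> where \<open>\<psi>\<close>, the negative half, is \<open>C^1\<close> and Lipschitz
  (\<open>phi_series_eq\<close>, \<open>psi_C1\<close>, \<open>psi_Lipschitz\<close>). All roughness of \<open>\<phi>\<close> is in \<open>g\<close>, and \<open>g\<close> is exactly
  self-similar: \<open>g(b t) = lam g(t)\<close>.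

  If \<open>g = 0\<close>, then \<open>\<phi>\<close> is \<open>C^1\<close> and its graph has dimension \<open>1\<close>. Suppose \<open>g \<noteq> 0\<close>. The increments of
  \<open>g\<close> over distances at most \<open>1\<close> are bounded, and rescaling by powers of \<open>b\<close> turns this into an
  \<open>\<alpha>\<close>-Hoelder bound valid at all scales (\<open>g_Hoelder\<close>). In the other direction, \<open>q\<close> is the restriction
  of a function on the torus to a line, hence almost periodic, and for fixed \<open>t\<close> the increment
  \<open>s \<mapsto> g(s + t) - g(s)\<close> is almost periodic as well. A nonzero value of it therefore recurs, up to a
  factor \<open>1/2\<close>, within every interval of a certain fixed length. So \<open>g\<close> oscillates by at least a
  fixed amount on every such interval, and after rescaling it oscillates by at least a constant times
  \<open>r^\<alpha>\<close> on every interval of radius \<open>r\<close> (\<open>g_oscillation_scaled\<close>). Since \<open>\<alpha> < 1\<close>, the Lipschitz function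
  \<open>\<psi>\<close> cannot compensate this for small \<open>r\<close>. Thus \<open>\<phi>\<close> is \<open>\<alpha>\<close>-Hoelder and nowhere better, uniformly in
  the location, and counting boxes gives dimension \<open>2 - \<alpha>\<close>.

  It remains to read off from the Fourier coefficients whether \<open>g = 0\<close>. As \<open>g\<close> itself is unbounded
  when it is not zero, its increments are used here too: the mean of
  \<open>s \<mapsto> (g(s + t) - g(s)) e^(-i a s)\<close> is \<open>(e^(i a t) - 1)\<close> times the coefficient of the formal series at
  \<open>a\<close> (\<open>g_diff_mean\<close>). If all coefficients with \<open>a \<noteq> 0\<close> vanish, then so do all Fourier coefficients of
  the increments, the one at \<open>a = 0\<close> because of the factor, and \<open>g = 0\<close> by the uniqueness theorem for
  almost periodic functions (\<open>almost_periodic_uniqueness\<close>); conversely \<open>g = 0\<close> forces the coefficients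
  to vanish.
\<close>

section \<open>Box dimension of graphs\<close>

lemma totally_bounded_if_compact:
  fixes X :: "'a::metric_space set"
  assumes "compact X"
  shows "totally_bounded X"
  unfolding totally_bounded_metric
proof (intro allI impI)
  fix e :: real assume "e > 0"
  then obtain k where k: "finite k" "X \<subseteq> (\<Union>x\<in>k. ball x e)"
    using assms unfolding compact_eq_totally_bounded by blast
  then show "\<exists>k. finite k \<and> X \<subseteq> (\<Union>x\<in>k. {y. dist x y < e})"
    by (intro exI[of _ k]) (auto simp: ball_def)
qed

lemma covering_number_le:
  assumes "finite C" "X \<subseteq> \<Union>C" "\<And>U. U \<in> C \<Longrightarrow> bounded U \<and> diameter U \<le> e"
  shows "covering_number X e \<le> card C"
  unfolding covering_number_def by (rule Least_le) (use assms in blast)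

lemma covering_number_attained:
  assumes "totally_bounded X" "e > 0"
  obtains C where "finite C" "card C = covering_number X e" "X \<subseteq> \<Union>C"
    "\<And>U x y. U \<in> C \<Longrightarrow> x \<in> U \<Longrightarrow> y \<in> U \<Longrightarrow> dist x y \<le> e"
proof -
  obtain k where k: "finite k" "X \<subseteq> (\<Union>x\<in>k. {y. dist x y < e/2})"
    using assms unfolding totally_bounded_metric by (metis half_gt_zero)
  define C0 where "C0 = (\<lambda>x. ball x (e/2)) ` k"
  have *: "\<exists>C. finite C \<and> card C = card C0 \<and> X \<subseteq> \<Union>C \<and> (\<forall>U\<in>C. bounded U \<and> diameter U \<le> e)"
  proof (intro exI[of _ C0] conjI ballI)
    show "finite C0" using k by (simp add: C0_def)
    show "X \<subseteq> \<Union>C0" using k by (auto simp: C0_def ball_def)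
    fix U assume "U \<in> C0"
    then obtain x where U: "U = ball x (e/2)" by (auto simp: C0_def)
    show "bounded U" using U by simp
    have "dist y z \<le> e" if "y \<in> U" "z \<in> U" for y z
      using that dist_triangle_half_r[of x y e z] by (auto simp: U less_imp_le)
    moreover have "U \<noteq> {}" using U assms by auto
    ultimately show "diameter U \<le> e"
      unfolding diameter_def by (auto intro!: cSUP_least)
  qed auto
  have "\<exists>C. finite C \<and> card C = covering_number X e \<and> X \<subseteq> \<Union>C \<and>
     (\<forall>U\<in>C. bounded U \<and> diameter U \<le> e)"
    unfolding covering_number_def
    by (rule LeastI[where P="\<lambda>N. \<exists>C. finite C \<and> card C = N \<and> X \<subseteq> \<Union>C \<and>
     (\<forall>U\<in>C. bounded U \<and> diameter U \<le> e)", OF *])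
  then obtain C where "finite C" "card C = covering_number X e" "X \<subseteq> \<Union>C" 
    "\<forall>U\<in>C. bounded U \<and> diameter U \<le> e" by blast
  then show ?thesis
    using diameter_bounded_bound by (intro that[of C]) force+
qed

text \<open>
  Constant factors in front of a power of \<open>e\<close> become additive constants after taking logarithms, and
  these disappear on division by \<open>- ln e\<close>. All dimension results below go through this criterion.
\<close>

lemma has_box_dim_if_power_bounds:
  fixes X :: "'a::metric_space set"
  assumes X: "totally_bounded X" and c: "0 < c" and C: "0 < C"
    and lower: "\<forall>\<^sub>F e in at_right 0. c * e powr (-d) \<le> real (covering_number X e)"
    and upper: "\<forall>\<^sub>F e in at_right 0. real (covering_number X e) \<le> C * e powr (-d)"
  shows "has_box_dim X d"
proof -
  have L: "filterlim (\<lambda>e::real. - ln e) at_top (at_right 0)"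
    using ln_at_0 filterlim_uminus_at_bot by blast
  have lim: "((\<lambda>e. ln K / (- ln e) + d) \<longlongrightarrow> d) (at_right 0)" for K :: real
    using tendsto_add[OF tendsto_divide_0[OF tendsto_const[of "ln K"]
          filterlim_at_top_imp_at_infinity[OF L]] tendsto_const[of d]] by simp
  have small: "\<forall>\<^sub>F e in at_right 0. 0 < e \<and> e < (1::real)"
    unfolding eventually_at_right_field by (intro exI[of _ 1]) auto
  have eq: "ln (K * e powr (-d)) / (- ln e) = ln K / (- ln e) + d"
    if "0 < K" "0 < e" "e < 1" for K e :: real
  proof -
    have "ln (K * e powr (-d)) = ln K + - d * ln e"
      using that by (subst ln_mult_pos) (auto simp: ln_powr)
    moreover have "ln e \<noteq> 0" using that by simp
    ultimately show ?thesis by (simp add: field_simps)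
  qed
  have "((\<lambda>e. ln (real (covering_number X e)) / (- ln e)) \<longlongrightarrow> d) (at_right 0)"
  proof (rule tendsto_sandwich[OF _ _ lim[of c] lim[of C]])
    show "\<forall>\<^sub>F e in at_right 0. ln c / (- ln e) + d \<le> ln (real (covering_number X e)) / (- ln e)"
      using small lower
    proof eventually_elim
      case (elim e)
      have "0 < c * e powr (-d)" using elim c by simp
      then have "ln (c * e powr (-d)) \<le> ln (real (covering_number X e))"
        using elim by (subst ln_le_cancel_iff) auto
      then have "ln (c * e powr (-d)) / (- ln e) \<le> ln (real (covering_number X e)) / (- ln e)"
        using elim by (intro divide_right_mono) auto
      then show ?case using elim c by (simp only: eq)
    qed
    show "\<forall>\<^sub>F e in at_right 0. ln (real (covering_number X e)) / (- ln e) \<le> ln C / (- ln e) + d"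
      using small lower upper
    proof eventually_elim
      case (elim e)
      have "0 < c * e powr (-d)" using elim c by simp
      then have "0 < real (covering_number X e)" using elim by linarith
      then have "ln (real (covering_number X e)) \<le> ln (C * e powr (-d))"
        using elim by (subst ln_le_cancel_iff) auto
      then have "ln (real (covering_number X e)) / (- ln e) \<le> ln (C * e powr (-d)) / (- ln e)"
        using elim by (intro divide_right_mono) auto
      then show ?case using elim C by (simp only: eq)
    qed
  qed
  then show ?thesis using X by (simp add: has_box_dim_def)
qed

text \<open>
  A set of diameter at most \<open>e\<close> lies in an interval of length \<open>2 e\<close> around any of its points, so the
  bound is countable subadditivity of Lebesgue measure. The index map \<open>T\<close> allows the covering sets to be
  the projections of members of a family that is counted with its own indices.
\<close>

lemma interval_cover_card:
  fixes a b e :: real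
  assumes "finite \<U>" "{a..b} \<subseteq> (\<Union>U\<in>\<U>. T U)" "0 \<le> e"
    and d: "\<And>U x y. U \<in> \<U> \<Longrightarrow> x \<in> T U \<Longrightarrow> y \<in> T U \<Longrightarrow> \<bar>x - y\<bar> \<le> e"
  shows "b - a \<le> 2 * e * real (card \<U>)"
proof (cases "a \<le> b")
  case True
  define c where "c U = (SOME x. x \<in> T U)" for U
  have sub: "T U \<subseteq> {c U - e..c U + e}" if U: "U \<in> \<U>" for U
  proof
    fix x assume x: "x \<in> T U"
    then have "c U \<in> T U" unfolding c_def by (rule someI)
    then show "x \<in> {c U - e..c U + e}" using d[OF U x, of "c U"] by (auto simp: abs_le_iff)
  qed
  have "b - a = measure lborel {a..b}" using True by simp
  also have "\<dots> \<le> measure lborel (\<Union>U\<in>\<U>. {c U - e..c U + e})"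
  proof (rule measure_mono_fmeasurable)
    show "{a..b} \<subseteq> (\<Union>U\<in>\<U>. {c U - e..c U + e})" using assms(2) sub by blast
    show "(\<Union>U\<in>\<U>. {c U - e..c U + e}) \<in> fmeasurable lborel"
      using assms(1) by (intro fmeasurable.finite_UN) (auto simp: fmeasurable_def emeasure_lborel_Icc_eq)
  qed simp
  also have "\<dots> \<le> (\<Sum>U\<in>\<U>. measure lborel {c U - e..c U + e})"
    using assms(1) by (intro measure_UNION_le) auto
  also have "\<dots> = 2 * e * real (card \<U>)" using \<open>0 \<le> e\<close> by simp
  finally show ?thesis .
qed (use assms in \<open>auto intro: order_trans[of _ 0]\<close>)

lemma real_card_int_interval_le:
  fixes a b :: real
  assumes "a \<le> b"
  shows "real (card {\<lfloor>a\<rfloor>..\<lfloor>b\<rfloor>}) \<le> b - a + 2"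
proof -
  have "\<lfloor>a\<rfloor> \<le> \<lfloor>b\<rfloor>" using assms by (rule floor_mono)
  then have "real (card {\<lfloor>a\<rfloor>..\<lfloor>b\<rfloor>}) = real_of_int (\<lfloor>b\<rfloor> + 1 - \<lfloor>a\<rfloor>)" by simp
  then show ?thesis by linarith
qed

text \<open>
  Cut the base into cells of width \<open>h = e / 2\<close>. Above each cell the graph stays within \<open>K h^\<alpha>\<close> of its value
  at a representative point, so it meets only about \<open>2 K h^(\<alpha> - 1)\<close> squares of side \<open>h\<close>, where the stack of
  squares is aligned with that value. The condition \<open>e < 2\<close>, that is \<open>h < 1\<close>, is used to absorb lower order
  terms into the leading power.
\<close>

lemma covering_number_graph_Hoelder:
  fixes f :: "real \<Rightarrow> real"
  assumes \<delta>: "0 < \<delta>" and \<alpha>: "0 < \<alpha>" "\<alpha> \<le> 1" and K: "0 \<le> K"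
    and Hoelder: "\<And>x y. x \<in> {-\<delta>..\<delta>} \<Longrightarrow> y \<in> {-\<delta>..\<delta>} \<Longrightarrow> \<bar>f x - f y\<bar> \<le> K * \<bar>x - y\<bar> powr \<alpha>"
    and e: "0 < e" "e < 2"
  shows "real (covering_number (graph_on {-\<delta>..\<delta>} f) e)
           \<le> (2 * \<delta> + 2) * (2 * K + 2) * 2 powr (2 - \<alpha>) * e powr (- (2 - \<alpha>))"
proof -
  define h where "h = e / 2"
  have h: "0 < h" "h \<le> 1" using e by (auto simp: h_def)
  define r where "r m = (SOME x. x \<in> {-\<delta>..\<delta>} \<and> \<lfloor>x / h\<rfloor> = m)" for m :: int
  define cell where "cell = (\<lambda>(m, n). {z::real\<times>real. \<lfloor>fst z / h\<rfloor> = m \<and> \<lfloor>(snd z - f (r m)) / h\<rfloor> = n})"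
  \<comment> \<open>half of the oscillation allowed above one cell, measured in units of \<open>h\<close>\<close>
  define w where "w = K * h powr (\<alpha> - 1)"
  define I where "I = {\<lfloor>-\<delta> / h\<rfloor>..\<lfloor>\<delta> / h\<rfloor>} \<times> {\<lfloor>-w\<rfloor>..\<lfloor>w\<rfloor>}"
  have w: "0 \<le> w" using K by (simp add: w_def)
  have fin: "finite I" by (simp add: I_def)
  have close: "\<bar>x - y\<bar> \<le> h" if "\<lfloor>(x - a) / h\<rfloor> = \<lfloor>(y - a) / h\<rfloor>" for x y a :: real
  proof -
    have "\<bar>(x - a) / h - (y - a) / h\<bar> < 1" using that by linarith
    moreover have "(x - a) / h - (y - a) / h = (x - y) / h" using h by (simp add: field_simps)
    ultimately have "\<bar>x - y\<bar> / h < 1" using h by simp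
    then show ?thesis using h by (simp add: divide_less_eq)
  qed
  have cover: "graph_on {-\<delta>..\<delta>} f \<subseteq> \<Union>(cell ` I)"
  proof
    fix z assume "z \<in> graph_on {-\<delta>..\<delta>} f"
    then obtain t where t: "t \<in> {-\<delta>..\<delta>}" "z = (t, f t)" by (auto simp: graph_on_def)
    define m where "m = \<lfloor>t / h\<rfloor>"
    have "r m \<in> {-\<delta>..\<delta>} \<and> \<lfloor>r m / h\<rfloor> = m"
      unfolding r_def by (rule someI[of _ t]) (use t m_def in auto)
    then have rm: "r m \<in> {-\<delta>..\<delta>}" "\<bar>t - r m\<bar> \<le> h"
      using close[of t 0 "r m"] by (auto simp: m_def)
    have "\<bar>f t - f (r m)\<bar> \<le> K * \<bar>t - r m\<bar> powr \<alpha>" using Hoelder t rm by auto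
    also have "\<dots> \<le> K * h powr \<alpha>"
      using rm \<alpha> K by (intro mult_left_mono powr_mono2) auto
    also have "\<dots> = w * h" using h by (simp add: w_def powr_diff)
    finally have "\<bar>(f t - f (r m)) / h\<bar> \<le> w" using h by (simp add: divide_le_eq)
    then have "-w \<le> (f t - f (r m)) / h" "(f t - f (r m)) / h \<le> w"
      by (auto simp only: abs_le_iff)
    moreover have "-\<delta> / h \<le> t / h" "t / h \<le> \<delta> / h"
      using t h by (intro divide_right_mono; simp)+
    ultimately have "(m, \<lfloor>(f t - f (r m)) / h\<rfloor>) \<in> I"
      unfolding I_def m_def by (simp only: mem_Times_iff fst_conv snd_conv atLeastAtMost_iff floor_mono)
    then show "z \<in> \<Union>(cell ` I)"
      by (rule UN_I) (simp add: cell_def t m_def)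
  qed
  have diam: "bounded U \<and> diameter U \<le> e" if "U \<in> cell ` I" for U
  proof -
    have d: "norm (z - z') \<le> e" if "z \<in> U" "z' \<in> U" for z z'
    proof -
      obtain m n where "U = cell (m, n)" using \<open>U \<in> cell ` I\<close> by auto
      then have "\<bar>fst z - fst z'\<bar> \<le> h" "\<bar>snd z - snd z'\<bar> \<le> h"
        using that close[of "fst z" 0 "fst z'"] close[of "snd z" "f (r m)" "snd z'"]
        by (auto simp: cell_def)
      then have "norm (fst (z - z'), snd (z - z')) \<le> h + h"
        by (intro order_trans[OF norm_Pair_le] add_mono) auto
      then show ?thesis unfolding prod.collapse by (simp add: h_def)
    qed
    have "bounded U"
    proof (cases "U = {}")
      case False
      then obtain z where "z \<in> U" by auto
      then have "U \<subseteq> cball z e" using d[of z] by (simp add: subset_iff dist_norm)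
      then show ?thesis using bounded_subset bounded_cball by blast
    qed simp
    then show ?thesis using d e by (auto intro: diameter_le)
  qed
  have "covering_number (graph_on {-\<delta>..\<delta>} f) e \<le> card (cell ` I)"
    using fin cover diam by (intro covering_number_le) auto
  also have "\<dots> \<le> card I" using fin by (rule card_image_le)
  finally have "real (covering_number (graph_on {-\<delta>..\<delta>} f) e) \<le> real (card I)" by simp
  also have "\<dots> = real (card {\<lfloor>-\<delta> / h\<rfloor>..\<lfloor>\<delta> / h\<rfloor>}) * real (card {\<lfloor>-w\<rfloor>..\<lfloor>w\<rfloor>})"
    by (simp add: I_def card_cartesian_product del: card_atLeastAtMost_int)
  also have "\<dots> \<le> (\<delta> / h - -\<delta> / h + 2) * (w - - w + 2)"
    using w h \<delta> by (intro mult_mono real_card_int_interval_le) auto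
  also have "\<dots> \<le> ((2 * \<delta> + 2) / h) * ((2 * K + 2) * h powr (\<alpha> - 1))"
  proof (intro mult_mono)
    show "\<delta> / h - - \<delta> / h + 2 \<le> (2 * \<delta> + 2) / h" using h by (simp add: field_simps)
    have "h powr 0 \<le> h powr (\<alpha> - 1)" using h \<alpha> by (intro powr_mono') auto
    then show "w - - w + 2 \<le> (2 * K + 2) * h powr (\<alpha> - 1)"
      using h by (simp add: w_def algebra_simps)
  qed (use w h \<delta> in auto)
  also have "\<dots> = (2 * \<delta> + 2) * (2 * K + 2) * h powr (- (2 - \<alpha>))"
  proof -
    have "h powr (- (2 - \<alpha>)) = h powr (\<alpha> - 1) / h"
      using powr_diff[of h "\<alpha> - 1" 1] h by simp
    then show ?thesis by (simp only: times_divide_eq_left times_divide_eq_right mult.assoc)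
  qed
  also have "h powr (- (2 - \<alpha>)) = 2 powr (2 - \<alpha>) * e powr (- (2 - \<alpha>))"
  proof -
    have "h powr (- (2 - \<alpha>)) = e powr (- (2 - \<alpha>)) / 2 powr (- (2 - \<alpha>))"
      unfolding h_def by (rule powr_divide)
    then show ?thesis using powr_minus_divide[of 2 "2 - \<alpha>"] by simp
  qed
  finally show ?thesis by (simp add: mult_ac)
qed

lemma totally_bounded_graph:
  assumes "continuous_on {a..b} f"
  shows "totally_bounded (graph_on {a..b} f)"
  unfolding graph_on_def
  by (intro totally_bounded_if_compact compact_continuous_image continuous_intros assms) auto

lemma continuous_on_if_Hoelder:
  fixes f :: "real \<Rightarrow> real"
  assumes "0 < \<alpha>" "\<And>x y. x \<in> S \<Longrightarrow> y \<in> S \<Longrightarrow> \<bar>f x - f y\<bar> \<le> K * \<bar>x - y\<bar> powr \<alpha>"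
  shows "continuous_on S f"
  unfolding continuous_on_def
proof
  fix x assume x: "x \<in> S"
  have "((\<lambda>y. f y - f x) \<longlongrightarrow> 0) (at x within S)"
  proof (rule Lim_null_comparison)
    show "\<forall>\<^sub>F y in at x within S. norm (f y - f x) \<le> K * \<bar>y - x\<bar> powr \<alpha>"
      unfolding eventually_at using assms x by (auto intro!: exI[of _ 1])
    have "((\<lambda>y. \<bar>y - x\<bar>) \<longlongrightarrow> 0) (at x within S)"
      by (auto intro!: tendsto_eq_intros)
    then have "((\<lambda>y. K * \<bar>y - x\<bar> powr \<alpha>) \<longlongrightarrow> K * 0 powr \<alpha>) (at x within S)"
      using assms(1) by (intro tendsto_intros) auto
    then show "((\<lambda>y. K * \<bar>y - x\<bar> powr \<alpha>) \<longlongrightarrow> 0) (at x within S)" by simp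
  qed
  then show "(f \<longlongrightarrow> f x) (at x within S)" by (rule LIM_zero_cancel)
qed

text \<open>
  A cover of the graph projects to a cover of the base interval, which has length \<open>2 \<delta>\<close>.
\<close>

lemma covering_number_graph_ge_width:
  fixes f :: "real \<Rightarrow> real"
  assumes \<delta>: "0 < \<delta>" and f: "continuous_on {-\<delta>..\<delta>} f" and e: "0 < e"
  shows "\<delta> / e \<le> real (covering_number (graph_on {-\<delta>..\<delta>} f) e)"
proof -
  obtain C where C: "finite C" "card C = covering_number (graph_on {-\<delta>..\<delta>} f) e"
      "graph_on {-\<delta>..\<delta>} f \<subseteq> \<Union>C"
    and d: "\<And>U x y. U \<in> C \<Longrightarrow> x \<in> U \<Longrightarrow> y \<in> U \<Longrightarrow> dist x y \<le> e"
    using covering_number_attained[OF totally_bounded_graph[OF f] e] by metis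
  have "\<delta> - - \<delta> \<le> 2 * e * real (card C)"
  proof (rule interval_cover_card[where T="\<lambda>U. fst ` U"])
    show "{-\<delta>..\<delta>} \<subseteq> (\<Union>U\<in>C. fst ` U)"
    proof
      fix t assume "t \<in> {-\<delta>..\<delta>}"
      then have "(t, f t) \<in> graph_on {-\<delta>..\<delta>} f" by (simp add: graph_on_def)
      then have "(t, f t) \<in> \<Union>C" using C(3) by blast
      then show "t \<in> (\<Union>U\<in>C. fst ` U)" by force
    qed
    fix U x y assume "U \<in> C" "x \<in> fst ` U" "y \<in> fst ` U"
    then obtain z z' where "z \<in> U" "z' \<in> U" "x = fst z" "y = fst z'" by auto
    then show "\<bar>x - y\<bar> \<le> e"
      using d[OF \<open>U \<in> C\<close>, of z z'] dist_fst_le[of z z'] by (simp add: dist_real_def)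
  qed (use C e in auto)
  then show ?thesis using e C by (simp add: divide_le_eq mult.commute)
qed

text \<open>
  By the intermediate value theorem the part of the graph above an interval of radius \<open>e\<close> projects
  vertically onto an interval of length at least \<open>c e^\<alpha>\<close>, so covering it takes at least about
  \<open>c e^(\<alpha> - 1) / 2\<close> sets. About \<open>\<delta> / (2 e)\<close> such intervals fit into the base with gaps exceeding \<open>e\<close>, and then
  no covering set serves two of them.
\<close>

lemma covering_number_graph_ge_oscillation:
  fixes f :: "real \<Rightarrow> real"
  assumes f: "continuous_on {-\<delta>..\<delta>} f" and c: "0 \<le> c"
    and e: "0 < e" "e \<le> \<delta> / 4"
    and osc: "\<And>s. \<exists>x y. \<bar>x - s\<bar> \<le> e \<and> \<bar>y - s\<bar> \<le> e \<and> c * e powr \<alpha> \<le> \<bar>f x - f y\<bar>"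
  shows "c * \<delta> / 8 * e powr (- (2 - \<alpha>)) \<le> real (covering_number (graph_on {-\<delta>..\<delta>} f) e)"
proof -
  obtain C where C: "finite C" "card C = covering_number (graph_on {-\<delta>..\<delta>} f) e"
      "graph_on {-\<delta>..\<delta>} f \<subseteq> \<Union>C"
    and d: "\<And>U x y. U \<in> C \<Longrightarrow> x \<in> U \<Longrightarrow> y \<in> U \<Longrightarrow> dist x y \<le> e"
    using covering_number_attained[OF totally_bounded_graph[OF f] e(1)] by metis
  define M where "M = nat \<lfloor>\<delta> / (2 * e)\<rfloor>"
  \<comment> \<open>spacing \<open>4 e\<close> between centres leaves gaps of width \<open>2 e\<close> between the intervals of radius \<open>e\<close>\<close>
  define s where "s m = -\<delta> + e + 4 * e * real m" for m
  define I where "I m = {s m - e..s m + e}" for m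
  define \<U> where "\<U> m = {U \<in> C. \<exists>t\<in>I m. (t, f t) \<in> U}" for m
  have I_sub: "I m \<subseteq> {-\<delta>..\<delta>}" if "m < M" for m
  proof -
    have "real M \<le> \<delta> / (2 * e)" using e by (simp add: M_def)
    then have "2 * e * real M \<le> \<delta>" using e by (simp add: field_simps)
    moreover have "real m + 1 \<le> real M" using that by simp
    then have "e * (real m + 1) \<le> e * real M" using e by (intro mult_left_mono) auto
    moreover have "0 \<le> e * real m" using e by simp
    ultimately show ?thesis unfolding I_def s_def using e
      by (auto simp: algebra_simps)
  qed
  have card_ge: "c * e powr \<alpha> / (2 * e) \<le> real (card (\<U> m))" if m: "m < M" for m
  proof -
    obtain x y where xy: "\<bar>x - s m\<bar> \<le> e" "\<bar>y - s m\<bar> \<le> e" "c * e powr \<alpha> \<le> \<bar>f x - f y\<bar>"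
      using osc by blast
    then have xyI: "x \<in> I m" "y \<in> I m" by (auto simp: I_def abs_le_iff)
    have conn: "connected (f ` I m)"
      unfolding I_def by (intro connected_continuous_image continuous_on_subset[OF f])
        (use I_sub[OF m] in \<open>auto simp: I_def\<close>)
    have seg: "{min (f x) (f y)..max (f x) (f y)} \<subseteq> f ` I m"
      using connected_contains_Icc[OF conn, of "f x" "f y"] connected_contains_Icc[OF conn, of "f y" "f x"] xyI
      by (auto simp: min_def max_def)
    have "max (f x) (f y) - min (f x) (f y) \<le> 2 * e * real (card (\<U> m))"
    proof (rule interval_cover_card[where T="\<lambda>U. snd ` U"])
      show "{min (f x) (f y)..max (f x) (f y)} \<subseteq> (\<Union>U\<in>\<U> m. snd ` U)"
      proof
        fix z assume "z \<in> {min (f x) (f y)..max (f x) (f y)}"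
        then obtain t where t: "t \<in> I m" "z = f t" using seg by blast
        then have "(t, f t) \<in> graph_on {-\<delta>..\<delta>} f" using I_sub[OF m] by (auto simp: graph_on_def)
        then have "(t, f t) \<in> \<Union>C" using C(3) by blast
        then obtain U where "U \<in> C" "(t, f t) \<in> U" by auto
        then have "U \<in> \<U> m" "z \<in> snd ` U" using t by (auto simp: \<U>_def intro!: image_eqI[of _ _ "(t, f t)"])
        then show "z \<in> (\<Union>U\<in>\<U> m. snd ` U)" by blast
      qed
      fix U x y assume U: "U \<in> \<U> m" "x \<in> snd ` U" "y \<in> snd ` U"
      then obtain z z' where "z \<in> U" "z' \<in> U" "x = snd z" "y = snd z'" by auto
      then show "\<bar>x - y\<bar> \<le> e"
        using d[of U z z'] U dist_snd_le[of z z'] by (simp add: dist_real_def \<U>_def)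
    qed (use C e in \<open>auto simp: \<U>_def\<close>)
    moreover have "max (f x) (f y) - min (f x) (f y) = \<bar>f x - f y\<bar>" by auto
    ultimately have "c * e powr \<alpha> \<le> 2 * e * real (card (\<U> m))" using xy(3) by linarith
    then show ?thesis using e by (simp add: divide_le_eq mult.commute)
  qed
  have disj: "\<U> m \<inter> \<U> n = {}" if "m < n" for m n
  proof (rule ccontr)
    assume "\<U> m \<inter> \<U> n \<noteq> {}"
    then obtain U x y where U: "U \<in> C" "x \<in> I m" "y \<in> I n" "(x, f x) \<in> U" "(y, f y) \<in> U"
      by (auto simp: \<U>_def)
    have "\<bar>x - y\<bar> \<le> e"
      using d[OF U(1,4,5)] dist_fst_le[of "(x, f x)" "(y, f y)"] by (simp add: dist_real_def)
    moreover have "e * (real m + 1) \<le> e * real n" using that e by (intro mult_left_mono) auto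
    ultimately show False using U(2,3) e(1) by (auto simp: I_def s_def algebra_simps)
  qed
  have "real M * (c * e powr \<alpha> / (2 * e)) = (\<Sum>m<M. c * e powr \<alpha> / (2 * e))" by simp
  also have "\<dots> \<le> (\<Sum>m<M. real (card (\<U> m)))" by (intro sum_mono card_ge) auto
  also have "\<dots> = real (card (\<Union>m\<in>{..<M}. \<U> m))"
  proof (subst card_UN_disjoint)
    show "\<forall>i\<in>{..<M}. \<forall>j\<in>{..<M}. i \<noteq> j \<longrightarrow> \<U> i \<inter> \<U> j = {}"
      using disj by (metis Int_commute nat_neq_iff)
  qed (use C in \<open>auto simp: \<U>_def\<close>)
  also have "\<dots> \<le> real (card C)"
    using C(1) by (intro of_nat_mono card_mono) (auto simp: \<U>_def)
  finally have "real M * (c * e powr \<alpha> / (2 * e)) \<le> real (card C)" .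
  moreover have "\<delta> / (4 * e) * (c * e powr \<alpha> / (2 * e)) \<le> real M * (c * e powr \<alpha> / (2 * e))"
  proof (intro mult_right_mono)
    have "\<delta> / (2 * e) - 1 \<le> real M" unfolding M_def by linarith
    moreover have "1 \<le> \<delta> / (4 * e)" using e by (simp add: field_simps)
    moreover have "\<delta> / (2 * e) = \<delta> / (4 * e) + \<delta> / (4 * e)" by (simp add: field_simps)
    ultimately show "\<delta> / (4 * e) \<le> real M" by linarith
  qed (use c e in auto)
  moreover have "\<delta> / (4 * e) * (c * e powr \<alpha> / (2 * e)) = c * \<delta> / 8 * e powr (- (2 - \<alpha>))"
  proof -
    have "e powr (- (2 - \<alpha>)) = e powr \<alpha> / e\<^sup>2"
      using e powr_diff[of e \<alpha> 2] by simp
    then show ?thesis by (simp add: power2_eq_square)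
  qed
  ultimately show ?thesis using C(2) by simp
qed

lemma has_box_dim_graph_Lipschitz:
  fixes f :: "real \<Rightarrow> real"
  assumes \<delta>: "0 < \<delta>" and K: "0 \<le> K"
    and Lip: "\<And>x y. x \<in> {-\<delta>..\<delta>} \<Longrightarrow> y \<in> {-\<delta>..\<delta>} \<Longrightarrow> \<bar>f x - f y\<bar> \<le> K * \<bar>x - y\<bar>"
  shows "has_box_dim (graph_on {-\<delta>..\<delta>} f) 1"
proof -
  have Hoelder: "\<bar>f x - f y\<bar> \<le> K * \<bar>x - y\<bar> powr 1"
    if "x \<in> {-\<delta>..\<delta>}" "y \<in> {-\<delta>..\<delta>}" for x y
    using Lip[OF that] by simp  have f: "continuous_on {-\<delta>..\<delta>} f"
    by (rule continuous_on_if_Hoelder[of 1 "{-\<delta>..\<delta>}" f K]) (simp, rule Hoelder)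
  show ?thesis
  proof (rule has_box_dim_if_power_bounds[OF totally_bounded_graph[OF f] \<delta>])
    show "0 < (2 * \<delta> + 2) * (2 * K + 2) * 2" using \<delta> K by simp
    show "\<forall>\<^sub>F e in at_right 0. \<delta> * e powr (-1) \<le> real (covering_number (graph_on {-\<delta>..\<delta>} f) e)"
      unfolding eventually_at_right_field
      using covering_number_graph_ge_width[OF \<delta> f]
      by (intro exI[of _ 1]) (auto simp: powr_minus_divide)
    show "\<forall>\<^sub>F e in at_right 0. real (covering_number (graph_on {-\<delta>..\<delta>} f) e) \<le> (2 * \<delta> + 2) * (2 * K + 2) * 2 * e powr (-1)"
      unfolding eventually_at_right_field
      using covering_number_graph_Hoelder[where \<alpha> = 1, OF \<delta> _ _ K Hoelder]
      by (intro exI[of _ 2]) auto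
  qed
qed

lemma has_box_dim_graph_exact_Hoelder:
  fixes f :: "real \<Rightarrow> real"
  assumes \<delta>: "0 < \<delta>" and K: "0 \<le> K" and c: "0 < c" and \<alpha>: "0 < \<alpha>" "\<alpha> \<le> 1"
    and Hoelder: "\<And>x y. x \<in> {-\<delta>..\<delta>} \<Longrightarrow> y \<in> {-\<delta>..\<delta>} \<Longrightarrow> \<bar>f x - f y\<bar> \<le> K * \<bar>x - y\<bar> powr \<alpha>"
    and osc: "\<forall>\<^sub>F r in at_right 0. \<forall>s. \<exists>x y. \<bar>x - s\<bar> \<le> r \<and> \<bar>y - s\<bar> \<le> r \<and> c * r powr \<alpha> \<le> \<bar>f x - f y\<bar>"
  shows "has_box_dim (graph_on {-\<delta>..\<delta>} f) (2 - \<alpha>)"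
proof -
  have f: "continuous_on {-\<delta>..\<delta>} f"
    by (rule continuous_on_if_Hoelder[of \<alpha> "{-\<delta>..\<delta>}" f K]) (rule \<alpha>, rule Hoelder)
  have small: "\<forall>\<^sub>F e in at_right 0. 0 < e \<and> e < min 2 (\<delta> / 4)"
    unfolding eventually_at_right_field using \<delta> by (intro exI[of _ "min 2 (\<delta> / 4)"]) auto
  show ?thesis
  proof (rule has_box_dim_if_power_bounds[OF totally_bounded_graph[OF f], where c = "c * \<delta> / 8"])
    show "0 < (2 * \<delta> + 2) * (2 * K + 2) * 2 powr (2 - \<alpha>)" using \<delta> K by simp
    show "0 < c * \<delta> / 8" using c \<delta> by simp
    show "\<forall>\<^sub>F e in at_right 0. c * \<delta> / 8 * e powr (- (2 - \<alpha>)) \<le> real (covering_number (graph_on {-\<delta>..\<delta>} f) e)"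
      using small osc
    proof eventually_elim
      case (elim e)
      show ?case
        by (rule covering_number_graph_ge_oscillation[OF f]) (use elim c in auto)
    qed
    show "\<forall>\<^sub>F e in at_right 0. real (covering_number (graph_on {-\<delta>..\<delta>} f) e) \<le> (2 * \<delta> + 2) * (2 * K + 2) * 2 powr (2 - \<alpha>) * e powr (- (2 - \<alpha>))"
      using small
    proof eventually_elim
      case (elim e)
      show ?case
        by (rule covering_number_graph_Hoelder[OF \<delta> \<alpha> K Hoelder]) (use elim in auto)
    qed
  qed
qed

section \<open>Mean values of functions on the line\<close>

definition time_avg :: "(real \<Rightarrow> complex) \<Rightarrow> real \<Rightarrow> complex" where
  "time_avg f T = complex_of_real (1 / (2 * T)) * integral {-T..T} f"

definition has_mean :: "(real \<Rightarrow> complex) \<Rightarrow> complex \<Rightarrow> bool" where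
  "has_mean f m \<longleftrightarrow> (time_avg f \<longlongrightarrow> m) at_top"

lemma has_mean_unique: "has_mean f m \<Longrightarrow> has_mean f m' \<Longrightarrow> m = m'"
  unfolding has_mean_def by (rule tendsto_unique[OF trivial_limit_at_top_linorder])

lemma time_avg_add:
  assumes "continuous_on UNIV f" "continuous_on UNIV g"
  shows "time_avg (\<lambda>t. f t + g t) T = time_avg f T + time_avg g T"
proof -
  have "f integrable_on {-T..T}" "g integrable_on {-T..T}"
    using assms by (auto intro!: integrable_continuous_real intro: continuous_on_subset)
  then show ?thesis by (simp add: time_avg_def integral_add algebra_simps)
qed

lemma time_avg_cmult: "time_avg (\<lambda>t. c * f t) T = c * time_avg f T"
  by (simp add: time_avg_def)

lemma norm_time_avg_le:
  assumes "continuous_on UNIV f" "\<And>t. norm (f t) \<le> K" "0 < T"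
  shows "norm (time_avg f T) \<le> K"
proof -
  have "norm (integral {-T..T} f) \<le> K * (T - - T)"
    using assms by (intro integral_bound) (auto intro: continuous_on_subset)
  moreover have "norm (complex_of_real (1 / (2 * T))) = 1 / (2 * T)"
    using assms(3) by (simp only: norm_of_real) simp
  ultimately have "norm (time_avg f T) \<le> 1 / (2 * T) * (K * (T - - T))"
    using assms(3) unfolding time_avg_def norm_mult by (intro mult_mono) auto
  then show ?thesis using assms(3) by simp
qed

lemma has_mean_add:
  assumes "continuous_on UNIV f" "continuous_on UNIV g" "has_mean f m" "has_mean g m'"
  shows "has_mean (\<lambda>t. f t + g t) (m + m')"
proof -
  have "time_avg (\<lambda>t. f t + g t) = (\<lambda>T. time_avg f T + time_avg g T)"
    using assms(1,2) by (intro ext time_avg_add)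
  then show ?thesis using assms(3,4) unfolding has_mean_def by (simp add: tendsto_add)
qed

lemma has_mean_cmult: "has_mean f m \<Longrightarrow> has_mean (\<lambda>t. c * f t) (c * m)"
  unfolding has_mean_def by (subst time_avg_cmult[abs_def]) (rule tendsto_mult_left)

lemma has_mean_sum:
  assumes "finite I" "\<And>i. i \<in> I \<Longrightarrow> continuous_on UNIV (f i)" "\<And>i. i \<in> I \<Longrightarrow> has_mean (f i) (m i)"
  shows "has_mean (\<lambda>t. \<Sum>i\<in>I. f i t) (\<Sum>i\<in>I. m i)"
  using assms
proof (induction rule: finite_induct)
  case empty
  have "time_avg (\<lambda>t. 0) = (\<lambda>T. 0)" by (simp add: time_avg_def fun_eq_iff)
  then show ?case by (simp add: has_mean_def)
next
  case (insert i I)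
  then show ?case by (simp add: has_mean_add continuous_on_sum)
qed

lemma has_mean_norm_le:
  assumes "continuous_on UNIV f" "\<And>t. norm (f t) \<le> K" "has_mean f m"
  shows "norm m \<le> K"
proof (rule tendsto_upperbound)
  show "((\<lambda>T. norm (time_avg f T)) \<longlongrightarrow> norm m) at_top"
    using assms(3) unfolding has_mean_def by (rule tendsto_norm)
  show "\<forall>\<^sub>F T in at_top. norm (time_avg f T) \<le> K"
    using eventually_gt_at_top[of 0]
    by eventually_elim (rule norm_time_avg_le[OF assms(1,2)])
qed simp

text \<open>
  Time averages over \<open>{-T..T}\<close> are contractions for the supremum norm, so averages of the approximants
  converge uniformly in \<open>T > 0\<close> and the two limits may be interchanged. Arbitrary filters \<open>G\<close> are needed
  because sums over the integers are limits along finite subsets.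
\<close>

lemma has_mean_uniform_limit:
  assumes "uniform_limit UNIV F f G" "G \<noteq> bot" "\<And>n. continuous_on UNIV (F n)"
    and "\<And>n. has_mean (F n) (m n)" and "(m \<longlongrightarrow> l) G"
  shows "has_mean f l"
  unfolding has_mean_def
proof (rule swap_uniform_limit'[where S = "{0<..}"])
  show "\<forall>\<^sub>F n in G. (time_avg (F n) \<longlongrightarrow> m n) at_top"
    using assms(4) by (simp add: has_mean_def)
  have f: "continuous_on UNIV f"
    by (rule uniform_limit_theorem[OF _ assms(1,2)]) (use assms(3) in auto)
  show "uniform_limit {0<..} (\<lambda>n. time_avg (F n)) (time_avg f) G"
  proof (rule uniform_limitI)
    fix e :: real assume e: "0 < e"
    show "\<forall>\<^sub>F n in G. \<forall>T\<in>{0<..}. dist (time_avg (F n) T) (time_avg f T) < e"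
      using uniform_limitD[OF assms(1) half_gt_zero[OF e]]
    proof eventually_elim
      case (elim n)
      show ?case
      proof
        fix T :: real assume T: "T \<in> {0<..}"
        have eq: "time_avg (\<lambda>t. (F n t - f t) + f t) T = time_avg (\<lambda>t. F n t - f t) T + time_avg f T"
          by (intro time_avg_add continuous_intros f assms(3))
        have "norm (time_avg (\<lambda>t. F n t - f t) T) \<le> e / 2"
          by (intro norm_time_avg_le continuous_intros f assms(3))
            (use elim T in \<open>auto simp: dist_norm less_imp_le\<close>)
        then show "dist (time_avg (F n) T) (time_avg f T) < e"
          using eq e by (simp add: dist_norm)
      qed
    qed
  qed
  show "\<forall>\<^sub>F x in at_top. x \<in> {0::real<..}" using eventually_gt_at_top[of "0::real"] by (simp only: greaterThan_iff)
qed (use assms in auto)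

lemma has_mean_cis:
  shows "has_mean (\<lambda>t. cis (a * t)) (if a = 0 then 1 else 0)"
proof (cases "a = 0")
  case True
  have "\<forall>\<^sub>F T in at_top. time_avg (\<lambda>t. cis (a * t)) T = 1"
    using eventually_gt_at_top[of 0]
    by eventually_elim (simp add: True time_avg_def scaleR_conv_of_real)
  then show ?thesis using True by (simp add: has_mean_def tendsto_eventually)
next
  case False
  have "(time_avg (\<lambda>t. cis (a * t)) \<longlongrightarrow> 0) at_top"
  proof (rule Lim_null_comparison)
    show "\<forall>\<^sub>F T in at_top. norm (time_avg (\<lambda>t. cis (a * t)) T) \<le> 1 / \<bar>a\<bar> * (1 / T)"
      using eventually_gt_at_top[of 0]
    proof eventually_elim
      case (elim T)
      define G where "G t = exp (\<i> * a * of_real t) / (\<i> * a)" for t :: real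
      have "((\<lambda>t. cis (a * t)) has_integral (G T - G (-T))) {-T..T}"
      proof (rule fundamental_theorem_of_calculus)
        fix t :: real
        have "((\<lambda>z. exp (\<i> * a * z) / (\<i> * a)) has_field_derivative exp (\<i> * a * of_real t)) (at (of_real t))"
          using False by (auto intro!: derivative_eq_intros)
        then have "(G has_vector_derivative exp (\<i> * a * of_real t)) (at t within {-T..T})"
          unfolding G_def by (rule has_vector_derivative_real_field)
        then show "(G has_vector_derivative cis (a * t)) (at t within {-T..T})"
          by (simp add: cis_conv_exp mult_ac)
      qed (use elim in simp)
      then have "integral {-T..T} (\<lambda>t. cis (a * t)) = G T - G (-T)" by (rule integral_unique)
      moreover have nG: "norm (G t) = 1 / \<bar>a\<bar>" for t
        using norm_cis[of "a * t"] by (simp add: G_def norm_divide norm_mult)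
      have "norm (G T - G (-T)) \<le> 2 / \<bar>a\<bar>"
        using norm_triangle_ineq4[of "G T" "G (-T)"] by (simp add: nG)
      moreover have "norm (complex_of_real (1 / (2 * T))) = 1 / (2 * T)"
        using elim by (simp only: norm_of_real) simp
      ultimately have "norm (time_avg (\<lambda>t. cis (a * t)) T) \<le> 1 / (2 * T) * (2 / \<bar>a\<bar>)"
        unfolding time_avg_def norm_mult using elim by (intro mult_mono) auto
      then show ?case by (simp add: mult.commute)
    qed
    have "((\<lambda>T::real. 1 / T) \<longlongrightarrow> 0) at_top"
      by (intro tendsto_divide_0[OF tendsto_const] filterlim_at_top_imp_at_infinity filterlim_ident)
    from tendsto_mult_left[OF this, of "1 / \<bar>a\<bar>"]
    show "((\<lambda>T. 1 / \<bar>a\<bar> * (1 / T)) \<longlongrightarrow> 0) at_top" by simp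
  qed
  then show ?thesis using False by (simp add: has_mean_def)
qed

section \<open>Almost periodic functions\<close>

inductive trig_poly :: "(real \<Rightarrow> complex) \<Rightarrow> bool" where
  monomial: "trig_poly (\<lambda>t. c * cis (a * t))"
| add: "trig_poly f \<Longrightarrow> trig_poly g \<Longrightarrow> trig_poly (\<lambda>t. f t + g t)"

lemma trig_poly_const: "trig_poly (\<lambda>t. c)"
  using trig_poly.monomial[of c 0] by simp

lemma trig_poly_sum:
  "finite I \<Longrightarrow> (\<And>i. i \<in> I \<Longrightarrow> trig_poly (f i)) \<Longrightarrow> trig_poly (\<lambda>t. \<Sum>i\<in>I. f i t)"
  by (induction rule: finite_induct) (auto intro: trig_poly.add trig_poly_const)

lemma trig_poly_cmult: "trig_poly f \<Longrightarrow> trig_poly (\<lambda>t. c * f t)"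
proof (induction rule: trig_poly.induct)
  case (monomial d a)
  then show ?case using trig_poly.monomial[of "c * d" a] by (simp add: mult.assoc)
qed (simp add: distrib_left trig_poly.add)

lemma trig_poly_mult_monomial: "trig_poly f \<Longrightarrow> trig_poly (\<lambda>t. f t * (d * cis (b * t)))"
proof (induction rule: trig_poly.induct)
  case (monomial c a)
  have "(\<lambda>t. c * cis (a * t) * (d * cis (b * t))) = (\<lambda>t. c * d * cis ((a + b) * t))"
    by (simp add: ring_distribs mult_ac flip: cis_mult)
  then show ?case using trig_poly.monomial[of "c * d" "a + b"] by (simp only:)
qed (simp add: distrib_right trig_poly.add)

lemma trig_poly_mult:
  assumes f: "trig_poly f" and g: "trig_poly g"
  shows "trig_poly (\<lambda>t. f t * g t)"
  using g by induction (auto simp: distrib_left intro: trig_poly_mult_monomial[OF f] trig_poly.add)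

lemma trig_poly_cnj: "trig_poly f \<Longrightarrow> trig_poly (\<lambda>t. cnj (f t))"
proof (induction rule: trig_poly.induct)
  case (monomial c a)
  then show ?case using trig_poly.monomial[of "cnj c" "-a"] by (simp add: cis_cnj)
qed (simp add: trig_poly.add)

lemma trig_poly_affine: "trig_poly f \<Longrightarrow> trig_poly (\<lambda>t. f (b * t + s))"
proof (induction rule: trig_poly.induct)
  case (monomial c a)
  have "(\<lambda>t. c * cis (a * (b * t + s))) = (\<lambda>t. c * cis (a * s) * cis (a * b * t))"
    by (simp add: distrib_left mult_ac flip: cis_mult)
  then show ?case using trig_poly.monomial[of "c * cis (a * s)" "a * b"] by (simp only:)
qed (simp add: trig_poly.add)

lemma continuous_on_trig_poly: "trig_poly f \<Longrightarrow> continuous_on UNIV f"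
  by (induction rule: trig_poly.induct) (auto intro!: continuous_intros)

lemma bounded_trig_poly: "trig_poly f \<Longrightarrow> \<exists>K. \<forall>t. norm (f t) \<le> K"
proof (induction rule: trig_poly.induct)
  case (monomial c a)
  then show ?case by (auto simp: norm_mult)
next
  case (add f g)
  then obtain K K' where "\<forall>t. norm (f t) \<le> K" "\<forall>t. norm (g t) \<le> K'" by auto
  then show ?case by (intro exI[of _ "K + K'"]) (auto intro: norm_triangle_mono)
qed

text \<open>
  The affine reparametrization is built into the statement because the mean does not see it: a
  nonconstant monomial has mean zero whatever its frequency and phase.
\<close>

lemma trig_poly_mean:
  "trig_poly f \<Longrightarrow> \<exists>m. \<forall>b s. b \<noteq> 0 \<longrightarrow> has_mean (\<lambda>t. f (b * t + s)) m"
proof (induction rule: trig_poly.induct)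
  case (monomial c a)
  have "has_mean (\<lambda>t. c * cis (a * (b * t + s))) (c * (if a = 0 then 1 else 0))" if "b \<noteq> 0" for b s
  proof -
    have "has_mean (\<lambda>t. c * cis (a * s) * cis (a * b * t)) (c * cis (a * s) * (if a * b = 0 then 1 else 0))"
      by (rule has_mean_cmult[OF has_mean_cis])
    moreover have "(\<lambda>t. c * cis (a * (b * t + s))) = (\<lambda>t. c * cis (a * s) * cis (a * b * t))"
      by (simp add: distrib_left mult_ac flip: cis_mult)
    moreover have "c * cis (a * s) * (if a * b = 0 then 1 else 0) = c * (if a = 0 then 1 else 0)"
      using that by simp
    ultimately show ?thesis by (simp only:)
  qed
  then show ?case by blast
next
  case (add f g)
  then obtain m m' where "\<forall>b s. b \<noteq> 0 \<longrightarrow> has_mean (\<lambda>t. f (b * t + s)) m"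
    "\<forall>b s. b \<noteq> 0 \<longrightarrow> has_mean (\<lambda>t. g (b * t + s)) m'" by auto
  then show ?case
    using add.hyps by (intro exI[of _ "m + m'"]) (auto intro!: has_mean_add continuous_on_trig_poly trig_poly_affine)
qed

text \<open>
  Bohr's almost periodic functions, described as the uniform closure of the trigonometric polynomials.
\<close>

definition almost_periodic :: "(real \<Rightarrow> complex) \<Rightarrow> bool" where
  "almost_periodic f \<longleftrightarrow> (\<forall>e>0. \<exists>P. trig_poly P \<and> (\<forall>t. norm (f t - P t) \<le> e))"

lemma almost_periodic_trig_poly: "trig_poly f \<Longrightarrow> almost_periodic f"
  unfolding almost_periodic_def by (metis diff_self norm_zero less_imp_le)

lemma almost_periodic_uniform_limit_trig_poly:
  assumes "almost_periodic f"
  obtains P where "\<And>n. trig_poly (P n)" "uniform_limit UNIV P f sequentially"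
    "\<And>n t. norm (f t - P n t) \<le> 1 / real (Suc n)"
proof -
  have "\<forall>n. \<exists>Q. trig_poly Q \<and> (\<forall>t. norm (f t - Q t) \<le> 1 / real (Suc n))"
    using assms unfolding almost_periodic_def by simp
  then obtain P where P: "\<And>n. trig_poly (P n)" "\<And>n t. norm (f t - P n t) \<le> 1 / real (Suc n)"
    by metis
  have "uniform_limit UNIV P f sequentially"
  proof (rule uniform_limitI)
    fix e :: real assume "0 < e"
    then have "\<forall>\<^sub>F n in sequentially. 1 / real (Suc n) < e"
      using order_tendstoD(2)[OF LIMSEQ_inverse_real_of_nat, of e] by (simp add: inverse_eq_divide)
    then show "\<forall>\<^sub>F n in sequentially. \<forall>t\<in>UNIV. dist (P n t) (f t) < e"
      by eventually_elim (use P(2) in \<open>auto simp: dist_norm norm_minus_commute intro: le_less_trans\<close>)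
  qed
  with P show ?thesis by (intro that)
qed

lemma almost_periodic_uniform_limit:
  assumes "uniform_limit UNIV F f G" "G \<noteq> bot" "\<And>n. almost_periodic (F n)"
  shows "almost_periodic f"
  unfolding almost_periodic_def
proof (intro allI impI)
  fix e :: real assume "0 < e"
  then obtain n where n: "\<forall>t. dist (F n t) (f t) < e / 2"
    using eventually_happens'[OF assms(2) uniform_limitD[OF assms(1), of "e / 2"]] by auto
  obtain P where P: "trig_poly P" "\<forall>t. norm (F n t - P t) \<le> e / 2"
    using assms(3)[of n] \<open>0 < e\<close> unfolding almost_periodic_def by (meson half_gt_zero)
  have "norm (f t - P t) \<le> e" for t
  proof -
    have "norm (f t - P t) \<le> norm (f t - F n t) + norm (F n t - P t)"
      using norm_triangle_ineq[of "f t - F n t" "F n t - P t"] by simp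
    also have "\<dots> \<le> e / 2 + e / 2" using n P(2) by (intro add_mono) (auto simp: dist_norm norm_minus_commute less_imp_le)
    finally show ?thesis by simp
  qed
  then show "\<exists>P. trig_poly P \<and> (\<forall>t. norm (f t - P t) \<le> e)" using P by blast
qed

lemma continuous_on_almost_periodic:
  assumes "almost_periodic f"
  shows "continuous_on UNIV f"
proof -
  obtain P where P: "\<And>n. trig_poly (P n)" "uniform_limit UNIV P f sequentially"
    using almost_periodic_uniform_limit_trig_poly[OF assms] by metis
  show ?thesis
    by (rule uniform_limit_theorem[OF _ P(2)]) (simp_all add: continuous_on_trig_poly P(1))
qed

lemma bounded_almost_periodic:
  assumes "almost_periodic f"
  obtains K where "0 \<le> K" "\<And>t. norm (f t) \<le> K"
proof -
  obtain P where P: "trig_poly P" "\<And>t. norm (f t - P t) \<le> 1"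
    using assms unfolding almost_periodic_def by (meson zero_less_one)
  obtain K where K: "\<And>t. norm (P t) \<le> K" using bounded_trig_poly[OF P(1)] by blast
  have "norm (f t) \<le> K + 1" for t
    using norm_triangle_ineq[of "P t" "f t - P t"] K[of t] P(2)[of t] by simp
  then show ?thesis using that[of "K + 1"] norm_ge_zero order_trans by blast
qed

lemma almost_periodic_cmult:
  assumes "almost_periodic f"
  shows "almost_periodic (\<lambda>t. c * f t)"
proof -
  obtain P where P: "\<And>n. trig_poly (P n)" "uniform_limit UNIV P f sequentially"
    using almost_periodic_uniform_limit_trig_poly[OF assms] by metis
  show ?thesis
    by (rule almost_periodic_uniform_limit[OF bounded_linear.uniform_limit[OF bounded_linear_mult_right[of c] P(2)]])
      (auto intro: almost_periodic_trig_poly trig_poly_cmult P(1))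
qed

lemma almost_periodic_affine:
  assumes "almost_periodic f"
  shows "almost_periodic (\<lambda>t. f (b * t + s))"
  using assms trig_poly_affine unfolding almost_periodic_def by meson

lemma almost_periodic_add:
  assumes "almost_periodic f" "almost_periodic g"
  shows "almost_periodic (\<lambda>t. f t + g t)"
proof -
  obtain P where P: "\<And>n. trig_poly (P n)" "uniform_limit UNIV P f sequentially"
    using almost_periodic_uniform_limit_trig_poly[OF assms(1)] by metis
  obtain Q where Q: "\<And>n. trig_poly (Q n)" "uniform_limit UNIV Q g sequentially"
    using almost_periodic_uniform_limit_trig_poly[OF assms(2)] by metis
  show ?thesis
    by (rule almost_periodic_uniform_limit[OF uniform_limit_add[OF P(2) Q(2)]])
      (auto intro: almost_periodic_trig_poly trig_poly.add P(1) Q(1))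
qed

lemma almost_periodic_mult:
  assumes "almost_periodic f" "almost_periodic g"
  shows "almost_periodic (\<lambda>t. f t * g t)"
proof -
  obtain P where P: "\<And>n. trig_poly (P n)" "uniform_limit UNIV P f sequentially"
    using almost_periodic_uniform_limit_trig_poly[OF assms(1)] by metis
  obtain Q where Q: "\<And>n. trig_poly (Q n)" "uniform_limit UNIV Q g sequentially"
    using almost_periodic_uniform_limit_trig_poly[OF assms(2)] by metis
  obtain K K' where "\<And>t. norm (f t) \<le> K" "\<And>t. norm (g t) \<le> K'"
    using bounded_almost_periodic assms by metis
  then have "bounded (f ` UNIV)" "bounded (g ` UNIV)" by (auto simp: bounded_iff)
  from uniform_lim_mult[OF P(2) Q(2) this] show ?thesis
    by (rule almost_periodic_uniform_limit)
      (auto intro: almost_periodic_trig_poly trig_poly_mult P(1) Q(1))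
qed

lemma almost_periodic_sum:
  "finite I \<Longrightarrow> (\<And>i. i \<in> I \<Longrightarrow> almost_periodic (f i)) \<Longrightarrow> almost_periodic (\<lambda>t. \<Sum>i\<in>I. f i t)"
  by (induction rule: finite_induct)
    (auto intro: almost_periodic_add almost_periodic_trig_poly trig_poly_const)

text \<open>
  The means of approximating trigonometric polynomials form a Cauchy sequence, since a mean is bounded
  by the supremum norm. Each of them is insensitive to affine reparametrization, hence so is the limit.
\<close>

lemma almost_periodic_mean:
  assumes "almost_periodic f"
  shows "\<exists>m. \<forall>b s. b \<noteq> 0 \<longrightarrow> has_mean (\<lambda>t. f (b * t + s)) m"
proof -
  obtain P where P: "\<And>n. trig_poly (P n)" "uniform_limit UNIV P f sequentially"
    and close: "\<And>n t. norm (f t - P n t) \<le> 1 / real (Suc n)"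
    using almost_periodic_uniform_limit_trig_poly[OF assms] by metis
  obtain m where m: "\<And>n b s. b \<noteq> 0 \<Longrightarrow> has_mean (\<lambda>t. P n (b * t + s)) (m n)"
    using trig_poly_mean[OF P(1)] by metis
  have mm: "norm (m n - m k) \<le> 1 / real (Suc n) + 1 / real (Suc k)" for n k
  proof (rule has_mean_norm_le)
    have "has_mean (\<lambda>t. (-1) * P k t) ((-1) * m k)"
      using m[of 1 k 0] by (intro has_mean_cmult) simp
    then have "has_mean (\<lambda>t. P n t + (-1) * P k t) (m n + (-1) * m k)"
      using m[of 1 n 0]
      by (intro has_mean_add continuous_intros continuous_on_trig_poly P) simp_all
    then show "has_mean (\<lambda>t. P n t - P k t) (m n - m k)" by simp
    show "continuous_on UNIV (\<lambda>t. P n t - P k t)"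
      by (intro continuous_intros continuous_on_trig_poly P)
    show "norm (P n t - P k t) \<le> 1 / real (Suc n) + 1 / real (Suc k)" for t
    proof -
      have "norm (P n t - P k t) \<le> norm (f t - P k t) + norm (f t - P n t)"
        using norm_triangle_ineq4[of "f t - P k t" "f t - P n t"] by simp
      then show ?thesis using close[of t n] close[of t k] by linarith
    qed
  qed
  have "Cauchy m"
  proof (rule metric_CauchyI)
    fix e :: real assume "0 < e"
    then obtain N where N: "\<forall>n\<ge>N. 1 / real (Suc n) < e / 2"
      using order_tendstoD(2)[OF LIMSEQ_inverse_real_of_nat, of "e / 2"]
      by (auto simp: inverse_eq_divide eventually_sequentially)
    then show "\<exists>M. \<forall>n\<ge>M. \<forall>k\<ge>M. dist (m n) (m k) < e"
    proof (intro exI[of _ N] allI impI)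
      fix n k assume "N \<le> n" "N \<le> k"
      then show "dist (m n) (m k) < e"
        using N[rule_format, of n] N[rule_format, of k] mm[of n k] by (simp add: dist_norm)
    qed
  qed
  then obtain l where l: "m \<longlonglongrightarrow> l" using Cauchy_convergent convergent_def by blast
  have "has_mean (\<lambda>t. f (b * t + s)) l" if "b \<noteq> 0" for b s
  proof (rule has_mean_uniform_limit[OF _ _ _ m[OF that] l])
    show "uniform_limit UNIV (\<lambda>n t. P n (b * t + s)) (\<lambda>t. f (b * t + s)) sequentially"
      using P(2) by (rule uniform_limit_compose') auto
    show "continuous_on UNIV (\<lambda>t. P n (b * t + s))" for n
      by (intro continuous_on_trig_poly trig_poly_affine P)
  qed simp
  then show ?thesis by blast
qed

lemma has_mean_affine:
  assumes "almost_periodic f" "has_mean f m" "b \<noteq> 0"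
  shows "has_mean (\<lambda>t. f (b * t + s)) m"
proof -
  obtain m' where m': "\<And>b s. b \<noteq> 0 \<Longrightarrow> has_mean (\<lambda>t. f (b * t + s)) m'"
    using almost_periodic_mean[OF assms(1)] by auto
  have "m = m'" using m'[of 1 0] assms(2) by (intro has_mean_unique) simp_all
  then show ?thesis using m'[OF assms(3), of s] by simp
qed

text \<open>
  Bochner's characterization: the translates of \<open>f\<close> are totally bounded in the supremum norm. Partitions
  of the set of translation parameters are used instead of finite nets because they can be intersected,
  which settles the case of sums.
\<close>

definition translates_precompact :: "(real \<Rightarrow> complex) \<Rightarrow> bool" where
  "translates_precompact f \<longleftrightarrow> (\<forall>e>0. \<exists>\<P>. finite \<P> \<and> \<Union>\<P> = UNIV \<and>
     (\<forall>X\<in>\<P>. \<forall>s\<in>X. \<forall>s'\<in>X. \<forall>t. norm (f (t + s) - f (t + s')) \<le> e))"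

lemma translates_precompactE:
  assumes "translates_precompact f" "0 < e"
  obtains \<P> where "finite \<P>" "\<Union>\<P> = UNIV"
    "\<forall>X\<in>\<P>. \<forall>s\<in>X. \<forall>s'\<in>X. \<forall>t. norm (f (t + s) - f (t + s')) \<le> e"
proof -
  obtain \<P> where P: "finite \<P> \<and> \<Union>\<P> = UNIV \<and>
     (\<forall>X\<in>\<P>. \<forall>s\<in>X. \<forall>s'\<in>X. \<forall>t. norm (f (t + s) - f (t + s')) \<le> e)"
    using assms(1)[unfolded translates_precompact_def, rule_format, OF assms(2)] by (rule exE)
  show ?thesis by (rule that[of \<P>]) (simp_all add: P)
qed

text \<open>
  For a monomial the translate by \<open>s\<close> depends only on the point \<open>cis (a * s)\<close> of the unit circle, which is
  compact. For a sum, intersect the partitions of the summands.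
\<close>

lemma translates_precompact_trig_poly: "trig_poly f \<Longrightarrow> translates_precompact f"
proof (induction rule: trig_poly.induct)
  case (monomial c a)
  show ?case unfolding translates_precompact_def
  proof (intro allI impI)
    fix e :: real assume e: "0 < e"
    define r where "r = e / (2 * (norm c + 1))"
    have "0 < norm c + 1" using norm_ge_zero[of c] by linarith
    then have r: "0 < r" "norm c * (2 * r) \<le> e"
      using e by (simp_all add: r_def pos_divide_le_eq algebra_simps)
    have "compact (cball (0::complex) 1)" by simp
    then obtain k where k: "finite k" "cball (0::complex) 1 \<subseteq> (\<Union>x\<in>k. ball x r)"
      using r(1) unfolding compact_eq_totally_bounded by blast
    define \<P> where "\<P> = (\<lambda>z. {s. cis (a * s) \<in> ball z r}) ` k"
    have "\<Union>\<P> = UNIV"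
    proof -
      have "cis (a * s) \<in> (\<Union>x\<in>k. ball x r)" for s
        using k(2) by (rule subsetD) simp
      then show ?thesis by (auto simp: \<P>_def)
    qed
    moreover have "norm (c * cis (a * (t + s)) - c * cis (a * (t + s'))) \<le> e"
      if s: "X \<in> \<P>" "s \<in> X" "s' \<in> X" for X s s' t
    proof -
      obtain z where z: "dist z (cis (a * s)) < r" "dist z (cis (a * s')) < r"
        using s by (auto simp: \<P>_def)
      then have d: "norm (cis (a * s) - cis (a * s')) \<le> 2 * r"
        using dist_triangle2[of "cis (a * s)" "cis (a * s')" z] by (simp add: dist_norm norm_minus_commute)
      have "c * cis (a * (t + s)) - c * cis (a * (t + s')) = c * cis (a * t) * (cis (a * s) - cis (a * s'))"
        by (simp add: algebra_simps flip: cis_mult)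
      then have "norm (c * cis (a * (t + s)) - c * cis (a * (t + s'))) = norm c * norm (cis (a * s) - cis (a * s'))"
        by (simp add: norm_mult)
      also have "\<dots> \<le> norm c * (2 * r)" by (rule mult_left_mono[OF d]) simp
      finally show ?thesis using r(2) by linarith
    qed
    ultimately show "\<exists>\<P>. finite \<P> \<and> \<Union>\<P> = UNIV \<and>
       (\<forall>X\<in>\<P>. \<forall>s\<in>X. \<forall>s'\<in>X. \<forall>t. norm (c * cis (a * (t + s)) - c * cis (a * (t + s'))) \<le> e)"
      using k(1) by (intro exI[of _ \<P>]) (auto simp: \<P>_def)
  qed
next
  case (add f g)
  show ?case unfolding translates_precompact_def
  proof (intro allI impI)
    fix e :: real assume e: "0 < e"
    obtain \<P> where P: "finite \<P>" "\<Union>\<P> = UNIV"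
      "\<forall>X\<in>\<P>. \<forall>s\<in>X. \<forall>s'\<in>X. \<forall>t. norm (f (t + s) - f (t + s')) \<le> e / 2"
      by (rule translates_precompactE[OF add.IH(1) half_gt_zero[OF e]])
    obtain \<Q> where Q: "finite \<Q>" "\<Union>\<Q> = UNIV"
      "\<forall>X\<in>\<Q>. \<forall>s\<in>X. \<forall>s'\<in>X. \<forall>t. norm (g (t + s) - g (t + s')) \<le> e / 2"
      by (rule translates_precompactE[OF add.IH(2) half_gt_zero[OF e]])
    define \<R> where "\<R> = (\<lambda>(X, Y). X \<inter> Y) ` (\<P> \<times> \<Q>)"
    have "\<Union>\<R> = \<Union>\<P> \<inter> \<Union>\<Q>" by (auto simp: \<R>_def)
    then have "\<Union>\<R> = UNIV" using P Q by simp
    moreover have "norm (f (t + s) + g (t + s) - (f (t + s') + g (t + s'))) \<le> e"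
      if "X \<in> \<R>" "s \<in> X" "s' \<in> X" for X s s' t
    proof -
      obtain Y Z where "Y \<in> \<P>" "Z \<in> \<Q>" "X = Y \<inter> Z" using \<open>X \<in> \<R>\<close> by (auto simp: \<R>_def)
      then have "norm (f (t + s) - f (t + s')) \<le> e / 2" "norm (g (t + s) - g (t + s')) \<le> e / 2"
        using P(3) Q(3) that by blast+
      then have "norm ((f (t + s) - f (t + s')) + (g (t + s) - g (t + s'))) \<le> e / 2 + e / 2"
        by (rule norm_triangle_mono)
      then show ?thesis by (simp add: algebra_simps)
    qed
    ultimately show "\<exists>\<P>. finite \<P> \<and> \<Union>\<P> = UNIV \<and>
       (\<forall>X\<in>\<P>. \<forall>s\<in>X. \<forall>s'\<in>X. \<forall>t. norm (f (t + s) + g (t + s) - (f (t + s') + g (t + s'))) \<le> e)"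
      using P(1) Q(1) by (intro exI[of _ \<R>]) (auto simp: \<R>_def)
  qed
qed

lemma translates_precompact_almost_periodic:
  assumes "almost_periodic f"
  shows "translates_precompact f"
  unfolding translates_precompact_def
proof (intro allI impI)
  fix e :: real assume e: "0 < e"
  obtain P where P: "trig_poly P" "\<And>t. norm (f t - P t) \<le> e / 3"
    using assms[unfolded almost_periodic_def, rule_format, of "e / 3"] e by auto
  obtain \<P> where *: "finite \<P>" "\<Union>\<P> = UNIV"
    "\<forall>X\<in>\<P>. \<forall>s\<in>X. \<forall>s'\<in>X. \<forall>t. norm (P (t + s) - P (t + s')) \<le> e / 3"
    by (rule translates_precompactE[OF translates_precompact_trig_poly[OF P(1)], of "e / 3"]) (use e in simp)
  have "norm (f (t + s) - f (t + s')) \<le> e" if "X \<in> \<P>" "s \<in> X" "s' \<in> X" for X s s' t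
  proof -
    have "norm ((f (t + s) - P (t + s)) + (P (t + s) - P (t + s')) + (P (t + s') - f (t + s'))) \<le> e / 3 + e / 3 + e / 3"
      using P(2)[of "t + s"] P(2)[of "t + s'"] *(3)[rule_format, OF that, of t]
      by (intro norm_triangle_mono) (auto simp: norm_minus_commute)
    then show ?thesis by simp
  qed
  with *(1,2) show "\<exists>\<P>. finite \<P> \<and> \<Union>\<P> = UNIV \<and>
     (\<forall>X\<in>\<P>. \<forall>s\<in>X. \<forall>s'\<in>X. \<forall>t. norm (f (t + s) - f (t + s')) \<le> e)"
    by (intro exI[of _ \<P>]) blast
qed

text \<open>
  A nonzero value recurs with bounded gaps. Given \<open>s\<close>, let \<open>r\<close> be the representative of its class in a
  partition for the tolerance \<open>\<bar>f(t0)\<bar> / 2\<close>; comparing the translates by \<open>s\<close> and \<open>r\<close> at the point \<open>t0 - r\<close> gives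
  that \<open>f(s + (t0 - r))\<close> is close to \<open>f(t0)\<close>, and only finitely many shifts \<open>t0 - r\<close> occur.
\<close>

lemma almost_periodic_syndetic:
  assumes f: "almost_periodic f" and nz: "f t0 \<noteq> 0"
  obtains S c where "finite S" "0 < c" "\<forall>s. \<exists>d\<in>S. c \<le> norm (f (s + d))"
proof -
  define c where "c = norm (f t0) / 2"
  have c: "0 < c" using nz by (simp add: c_def)
  obtain \<P> where P: "finite \<P>" "\<Union>\<P> = UNIV"
    "\<forall>X\<in>\<P>. \<forall>s\<in>X. \<forall>s'\<in>X. \<forall>t. norm (f (t + s) - f (t + s')) \<le> c"
    by (rule translates_precompactE[OF translates_precompact_almost_periodic[OF f] c])
  define rep where "rep X = (SOME s. s \<in> X)" for X :: "real set"
  define S where "S = (\<lambda>X. t0 - rep X) ` \<P>"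
  have "\<exists>d\<in>S. c \<le> norm (f (s + d))" for s
  proof -
    obtain X where X: "X \<in> \<P>" "s \<in> X" using P(2) by blast
    then have "rep X \<in> X" unfolding rep_def by (intro someI)
    then have "norm (f (t0 - rep X + s) - f (t0 - rep X + rep X)) \<le> c" using P(3) X by blast
    then have "norm (f t0) - norm (f (s + (t0 - rep X))) \<le> c"
      using norm_triangle_ineq3[of "f t0" "f (s + (t0 - rep X))"]
      by (simp add: norm_minus_commute algebra_simps)
    then show ?thesis using X(1) by (intro bexI[of _ "t0 - rep X"]) (auto simp: S_def c_def)
  qed
  then show ?thesis using that[of S c] P(1) c by (simp add: S_def)
qed

text \<open>
  If \<open>f\<close> has a nonzero value, the finite sum of the translates of \<open>\<bar>f\<bar>^2\<close> by the shifts in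
  \<open>almost_periodic_syndetic\<close> is bounded below by a positive constant, so its mean is positive. But that mean
  is a multiple of the mean of \<open>\<bar>f\<bar>^2\<close>.
\<close>

lemma almost_periodic_eq_0_if_mean_square_0:
  assumes f: "almost_periodic f" and mean: "has_mean (\<lambda>t. f t * cnj (f t)) 0"
  shows "f t0 = 0"
proof (rule ccontr)
  assume "f t0 \<noteq> 0"
  then obtain S c where S: "finite S" "0 < c" "\<forall>s. \<exists>d\<in>S. c \<le> norm (f (s + d))"
    by (rule almost_periodic_syndetic[OF f])
  have cnj: "almost_periodic (\<lambda>t. cnj (f t))"
    using f unfolding almost_periodic_def
    by (metis complex_cnj_diff complex_mod_cnj trig_poly_cnj)
  define h where "h s = (\<Sum>d\<in>S. (norm (f (s + d)))\<^sup>2)" for s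
  have hc: "continuous_on UNIV h"
    unfolding h_def
    by (intro continuous_intros continuous_on_compose2[OF continuous_on_almost_periodic[OF f]]) auto
  have h_ge: "c\<^sup>2 \<le> h s" for s
  proof -
    obtain d where d: "d \<in> S" "c \<le> norm (f (s + d))" using S(3) by blast
    have "c\<^sup>2 \<le> (norm (f (s + d)))\<^sup>2" using d S(2) by (intro power_mono) auto
    also have "\<dots> \<le> h s" unfolding h_def using d S(1) by (intro member_le_sum) auto
    finally show ?thesis .
  qed
  have "has_mean (\<lambda>s. \<Sum>d\<in>S. f (s + d) * cnj (f (s + d))) (\<Sum>d\<in>S. 0)"
  proof (rule has_mean_sum[OF S(1)])
    fix d
    show "has_mean (\<lambda>s. f (s + d) * cnj (f (s + d))) 0"
      using has_mean_affine[OF almost_periodic_mult[OF f cnj] mean, of 1 d] by simp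
    show "continuous_on UNIV (\<lambda>s. f (s + d) * cnj (f (s + d)))"
      using continuous_on_almost_periodic[OF almost_periodic_affine[OF almost_periodic_mult[OF f cnj], of 1 d]] by simp
  qed
  then have "has_mean (\<lambda>s. complex_of_real (h s)) 0"
    by (simp add: h_def complex_norm_square del: of_real_power)
  then have "((\<lambda>T. Re (time_avg (\<lambda>s. complex_of_real (h s)) T)) \<longlongrightarrow> Re 0) at_top"
    unfolding has_mean_def by (rule tendsto_Re)
  moreover have "\<forall>\<^sub>F T in at_top. c\<^sup>2 \<le> Re (time_avg (\<lambda>s. complex_of_real (h s)) T)"
    using eventually_gt_at_top[of 0]
  proof eventually_elim
    case (elim T)
    have hi: "h integrable_on {-T..T}"
      by (intro integrable_continuous_real continuous_on_subset[OF hc]) auto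
    have "c\<^sup>2 * (2 * T) = integral {-T..T} (\<lambda>_. c\<^sup>2)" using elim by simp
    also have "\<dots> \<le> integral {-T..T} h"
      by (intro integral_le hi h_ge) auto
    finally have "c\<^sup>2 \<le> 1 / (2 * T) * integral {-T..T} h" using elim by (simp add: field_simps)
    moreover have "integral {-T..T} (\<lambda>s. complex_of_real (h s)) = complex_of_real (integral {-T..T} h)"
      using has_integral_of_real[OF integrable_integral[OF hi]] by (rule integral_unique)
    then have "time_avg (\<lambda>s. complex_of_real (h s)) T = complex_of_real (1 / (2 * T) * integral {-T..T} h)"
      by (simp only: time_avg_def of_real_mult)
    ultimately show ?case by (simp only: Re_complex_of_real)
  qed
  ultimately have "c\<^sup>2 \<le> Re 0"
    by (rule tendsto_lowerbound) simp
  then show False using S(2) by simp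
qed

text \<open>
  Vanishing Fourier coefficients make \<open>f\<close> orthogonal to every trigonometric polynomial, hence to
  their uniform limits and in particular to \<open>f\<close> itself.
\<close>

theorem almost_periodic_uniqueness:
  assumes f: "almost_periodic f" and zero: "\<And>a. has_mean (\<lambda>t. f t * cis (- (a * t))) 0"
  shows "f t = 0"
proof (rule almost_periodic_eq_0_if_mean_square_0[OF f])
  have orth: "has_mean (\<lambda>t. f t * cnj (P t)) 0" if "trig_poly P" for P
    using that
  proof induction
    case (monomial c a)
    have "(\<lambda>t. f t * cnj (c * cis (a * t))) = (\<lambda>t. cnj c * (f t * cis (- (a * t))))"
      by (simp add: cis_cnj mult_ac)
    then show ?case using has_mean_cmult[OF zero[of a], of "cnj c"] by simp
  next
    case (add P Q)
    have "has_mean (\<lambda>t. f t * cnj (P t) + f t * cnj (Q t)) (0 + 0)"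
      by (intro has_mean_add add.IH continuous_intros continuous_on_almost_periodic[OF f]
          continuous_on_trig_poly add.hyps)
    then show ?case by (simp add: distrib_left)
  qed
  obtain P where P: "\<And>n. trig_poly (P n)" "uniform_limit UNIV P f sequentially"
    using almost_periodic_uniform_limit_trig_poly[OF f] by metis
  obtain K where K: "\<And>t. norm (f t) \<le> K" using bounded_almost_periodic[OF f] by metis
  show "has_mean (\<lambda>t. f t * cnj (f t)) 0"
  proof (rule has_mean_uniform_limit[OF _ _ _ orth[OF P(1)] tendsto_const])
    have "uniform_limit UNIV (\<lambda>n t. cnj (P n t)) (\<lambda>t. cnj (f t)) sequentially"
      by (rule bounded_linear.uniform_limit[OF bounded_linear_cnj P(2)])
    moreover have "bounded (f ` UNIV)" "bounded ((\<lambda>t. cnj (f t)) ` UNIV)"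
      using K by (auto simp: bounded_iff)
    ultimately show "uniform_limit UNIV (\<lambda>n t. f t * cnj (P n t)) (\<lambda>t. f t * cnj (f t)) sequentially"
      by (intro uniform_lim_mult uniform_limit_const)
    show "continuous_on UNIV (\<lambda>t. f t * cnj (P n t))" for n
      by (intro continuous_intros continuous_on_almost_periodic[OF f] continuous_on_trig_poly P)
  qed simp
qed

section \<open>Functions on the torus along a line\<close>

lemma torus_representative:
  fixes x :: "real^'k"
  obtains y where "y \<in> cbox 0 1" "\<And>i. (x - y) $ i \<in> \<int>"
proof
  show "(\<chi> i. frac (x $ i)) \<in> cbox 0 1"
    by (auto simp: mem_box_cart frac_ge_0 less_imp_le[OF frac_lt_1])
  show "(x - (\<chi> i. frac (x $ i))) $ i \<in> \<int>" for i by (simp add: frac_def)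
qed

lemma torus_fun_eq:
  assumes "torus_fun p" "\<And>i. (x - y) $ i \<in> \<int>"
  shows "p x = p y"
  using assms(1)[unfolded torus_fun_def, rule_format, of "x - y" y] assms(2) by simp

lemma torus_fun_bounded:
  fixes p :: "real^'k \<Rightarrow> real"
  assumes "torus_fun p" "continuous_on UNIV p"
  obtains K where "\<And>x. \<bar>p x\<bar> \<le> K"
proof -
  have "compact (p ` cbox 0 1)"
    by (intro compact_continuous_image continuous_on_subset[OF assms(2)]) auto
  then have "bounded (p ` cbox 0 1)" by (rule compact_imp_bounded)
  then obtain K where K: "\<And>y. y \<in> cbox 0 1 \<Longrightarrow> \<bar>p y\<bar> \<le> K"
    unfolding bounded_iff by auto
  have "\<bar>p x\<bar> \<le> K" for x
  proof -
    obtain y where y: "y \<in> cbox 0 1" "\<And>i. (x - y) $ i \<in> \<int>"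
      using torus_representative[of x] by metis
    then show ?thesis using K torus_fun_eq[OF assms(1), of x y] by simp
  qed
  then show ?thesis by (rule that)
qed

lemma torus_fun_frechet_derivative:
  fixes p :: "real^'k \<Rightarrow> real"
  assumes p: "torus_fun p" "p differentiable_on UNIV"
  shows "torus_fun (\<lambda>x. frechet_derivative p (at x) u)"
  unfolding torus_fun_def
proof (intro allI impI)
  fix x m :: "real^'k" assume m: "\<forall>i. m $ i \<in> \<int>"
  have "(p has_derivative frechet_derivative p (at (x + m))) (at (x + m))"
    using p(2) by (simp add: differentiable_on_def frechet_derivative_works[symmetric])
  then have "((\<lambda>y. p (y + m)) has_derivative (\<lambda>h. frechet_derivative p (at (x + m)) h)) (at x)"
    by (rule has_derivative_compose[rotated]) (auto intro!: derivative_eq_intros)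
  moreover have "(\<lambda>y. p (y + m)) = p" using p(1) m by (simp add: torus_fun_def)
  ultimately have "(p has_derivative (\<lambda>h. frechet_derivative p (at (x + m)) h)) (at x)" by simp
  from frechet_derivative_at[OF this]
  show "frechet_derivative p (at (x + m)) u = frechet_derivative p (at x) u" by metis
qed

lemma Ck_fun_continuous: "Ck_fun m f \<Longrightarrow> continuous_on UNIV f"
  by (cases m) (auto intro: differentiable_imp_continuous_on)

text \<open>
  The derivative along the line is the restriction of the directional derivative of \<open>p\<close>, again a
  continuous function on the torus and therefore bounded.
\<close>

lemma line_fun_derivative:
  fixes p :: "real^'k \<Rightarrow> real"
  assumes p: "torus_fun p" "Ck_fun (Suc m) p"
  obtains q' K where "\<And>t. (line_fun p x0 u has_real_derivative q' t) (at t)"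
    "continuous_on UNIV q'" "\<And>t. \<bar>q' t\<bar> \<le> K"
proof -
  define p' where "p' x = frechet_derivative p (at x) u" for x
  have diff: "p differentiable_on UNIV" and c: "continuous_on UNIV p'"
    using p(2) Ck_fun_continuous unfolding p'_def by auto
  have "torus_fun p'" unfolding p'_def by (rule torus_fun_frechet_derivative[OF p(1) diff])
  then obtain K where K: "\<And>x. \<bar>p' x\<bar> \<le> K" using torus_fun_bounded c by metis
  show ?thesis
  proof (rule that[of "\<lambda>t. p' (t *\<^sub>R u + x0)" K])
    fix t
    let ?D = "frechet_derivative p (at (t *\<^sub>R u + x0))"
    have D: "(p has_derivative ?D) (at (t *\<^sub>R u + x0))"
      using diff by (simp add: differentiable_on_def frechet_derivative_works[symmetric])
    have "((\<lambda>t. p (t *\<^sub>R u + x0)) has_derivative (\<lambda>h. ?D (h *\<^sub>R u))) (at t)"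
      by (rule has_derivative_compose[where g = p and f = "\<lambda>t. t *\<^sub>R u + x0", OF _ D]) (auto intro!: derivative_eq_intros)
    moreover have "(\<lambda>h. ?D (h *\<^sub>R u)) = (\<lambda>h. h * p' (t *\<^sub>R u + x0))"
      using linear_frechet_derivative[of p "at (t *\<^sub>R u + x0)"] diff
      by (simp add: differentiable_on_def p'_def linear_cmul)
    ultimately show "(line_fun p x0 u has_real_derivative p' (t *\<^sub>R u + x0)) (at t)"
      by (simp add: has_field_derivative_def line_fun_def[abs_def] mult.commute[of _ "p' (t *\<^sub>R u + x0)"])
    show "\<bar>p' (t *\<^sub>R u + x0)\<bar> \<le> K" by (rule K)
  qed (intro continuous_on_compose2[OF c] continuous_intros, auto)
qed

text \<open>
  The standard embedding of the torus as a product of unit circles. It turns functions on the torus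
  into functions on a compact subset of a Euclidean space, where polynomial approximation is available.
\<close>

definition torus_embed :: "real^'k \<Rightarrow> complex^'k" where
  "torus_embed x = (\<chi> i. cis (2 * pi * x $ i))"

lemma continuous_on_torus_embed: "continuous_on S torus_embed"
  unfolding torus_embed_def[abs_def]
  by (intro continuous_on_vec_lambda continuous_on_cis continuous_intros)

lemma torus_embed_eq_iff: "torus_embed x = torus_embed y \<longleftrightarrow> (\<forall>i. (x - y) $ i \<in> \<int>)"
proof -
  have "cis (2 * pi * a) = cis (2 * pi * b) \<longleftrightarrow> a - b \<in> \<int>" for a b :: real
  proof -
    have "cis (2 * pi * a) = cis (2 * pi * b) \<longleftrightarrow> cis (2 * pi * (a - b)) = 1"
      by (simp add: right_diff_distrib flip: cis_divide)
    also have "\<dots> \<longleftrightarrow> (\<exists>n. 2 * pi * (a - b) = of_int n * 2 * pi)"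
      unfolding cos_one_2pi_int[symmetric] using cos_one_sin_zero[of "2 * pi * (a - b)"]
      by (auto simp: complex_eq_iff)
    also have "\<dots> \<longleftrightarrow> a - b \<in> \<int>" by (auto simp: Ints_def)
    finally show ?thesis .
  qed
  then show ?thesis by (simp add: torus_embed_def vec_eq_iff)
qed

text \<open>
  \<open>torus_embed\<close> restricted to the compact unit cube is a closed map onto its image, hence a quotient map,
  so the induced function on the image is continuous.
\<close>

lemma torus_fun_factors:
  fixes p :: "real^'k \<Rightarrow> real"
  assumes p: "torus_fun p" "continuous_on UNIV p"
  obtains F where "continuous_on (torus_embed ` cbox 0 1) F" "\<And>x. F (torus_embed x) = p x"
    "\<And>x :: real^'k. torus_embed x \<in> torus_embed ` cbox 0 1"
proof -
  define F where "F z = p (SOME x. torus_embed x = z)" for z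
  have F: "F (torus_embed x) = p x" for x
  proof -
    have "torus_embed (SOME y. torus_embed y = torus_embed x) = torus_embed x"
      by (rule someI[of "\<lambda>y. torus_embed y = torus_embed x"]) simp
    then show ?thesis unfolding F_def torus_embed_eq_iff by (intro torus_fun_eq[OF p(1)]) blast
  qed
  have p_eq: "p x = p y" if "torus_embed x = torus_embed y" for x y
    using F[of x] F[of y] that by simp
  have "continuous_on (torus_embed ` cbox 0 1) F"
    unfolding continuous_on_closed_invariant
  proof (intro allI impI)
    fix B :: "real set" assume B: "closed B"
    have "compact (torus_embed ` (cbox 0 1 \<inter> p -` B))"
      by (intro compact_continuous_image continuous_on_torus_embed compact_Int_closed
          closed_vimage[OF B] p(2)) auto
    moreover have "torus_embed ` (cbox 0 1 \<inter> p -` B) \<inter> torus_embed ` cbox 0 1 = F -` B \<inter> torus_embed ` cbox 0 1"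
      by (auto simp: F dest: p_eq)
    ultimately show "\<exists>A. closed A \<and> A \<inter> torus_embed ` cbox 0 1 = F -` B \<inter> torus_embed ` cbox 0 1"
      by (blast intro: compact_imp_closed)
  qed
  moreover have "torus_embed x \<in> torus_embed ` cbox 0 1" for x :: "real^'k"
    using torus_representative[of x] torus_embed_eq_iff by (metis imageI)
  ultimately show ?thesis using F that by blast
qed

text \<open>
  Along a line, the real and imaginary parts of the coordinates of \<open>torus_embed\<close> are linear combinations
  of \<open>cis (a t)\<close> and \<open>cis (- a t)\<close>, and trigonometric polynomials form an algebra.
\<close>

lemma trig_poly_real_polynomial_on_line:
  fixes u x0 :: "real^'k"
  assumes "real_polynomial_function P"
  shows "trig_poly (\<lambda>t. complex_of_real (P (torus_embed (t *\<^sub>R u + x0))))"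
  using assms
proof induction
  case (linear f)
  have coord: "trig_poly (\<lambda>t. complex_of_real (torus_embed (t *\<^sub>R u + x0) \<bullet> b))" if Basis: "b \<in> Basis" for b :: "complex^'k"
  proof -
    obtain i w where b: "b = axis i w" using Basis by (auto simp: Basis_vec_def)
    define d where "d = cis (2 * pi * x0 $ i)"
    define a where "a = 2 * pi * u $ i"
    have z: "torus_embed (t *\<^sub>R u + x0) $ i = d * cis (a * t)" for t
      by (simp add: torus_embed_def d_def a_def cis_mult distrib_left mult_ac add.commute)
    have inner: "complex_of_real (v \<bullet> w) = (v * cnj w + cnj v * w) / 2" for v
      by (simp add: complex_eq_iff inner_complex_def)
    have "complex_of_real (torus_embed (t *\<^sub>R u + x0) \<bullet> b)
        = d * cnj w / 2 * cis (a * t) + cnj d * w / 2 * cis (- a * t)" for t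
      unfolding b inner_axis z inner by (simp add: cis_cnj add_divide_distrib mult_ac)
    then show ?thesis by (simp only:) (intro trig_poly.intros)
  qed
  interpret bounded_linear f by fact
  have "complex_of_real (f (torus_embed (t *\<^sub>R u + x0)))
      = (\<Sum>b\<in>Basis. complex_of_real (f b) * complex_of_real (torus_embed (t *\<^sub>R u + x0) \<bullet> b))" for t
  proof -
    have "f (torus_embed (t *\<^sub>R u + x0)) = f (\<Sum>b\<in>Basis. (torus_embed (t *\<^sub>R u + x0) \<bullet> b) *\<^sub>R b)"
      by (simp only: euclidean_representation)
    then show ?thesis by (simp add: sum scaleR mult.commute)
  qed
  then show ?case
    by (simp only:) (intro trig_poly_sum trig_poly_cmult coord finite_Basis)
qed (auto intro: trig_poly_const trig_poly.add trig_poly_mult)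

text \<open>
  Approximate the induced function on the embedded torus by a polynomial, by the Stone-Weierstrass
  theorem, and restrict to the line.
\<close>

lemma almost_periodic_line_fun:
  fixes p :: "real^'k \<Rightarrow> real"
  assumes p: "torus_fun p" "continuous_on UNIV p"
  shows "almost_periodic (\<lambda>t. complex_of_real (line_fun p x0 u t))"
  unfolding almost_periodic_def
proof (intro allI impI)
  fix e :: real assume e: "0 < e"
  obtain F where F: "continuous_on (torus_embed ` cbox 0 1) F" "\<And>x. F (torus_embed x) = p x"
    "\<And>x :: real^'k. torus_embed x \<in> torus_embed ` cbox 0 1"
    using torus_fun_factors[OF p] by blast
  have "compact (torus_embed ` cbox 0 (1 :: real^'k))"
    by (intro compact_continuous_image continuous_on_torus_embed) auto
  from Stone_Weierstrass_real_polynomial_function[OF this F(1) e]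
  obtain P where P: "real_polynomial_function P"
    "\<And>z. z \<in> torus_embed ` cbox 0 1 \<Longrightarrow> \<bar>F z - P z\<bar> < e" by blast
  have "norm (complex_of_real (line_fun p x0 u t) - complex_of_real (P (torus_embed (t *\<^sub>R u + x0)))) \<le> e" for t
    using P(2)[OF F(3)] by (simp add: F(2) line_fun_def less_imp_le flip: of_real_diff)
  then show "\<exists>P. trig_poly P \<and> (\<forall>t. norm (complex_of_real (line_fun p x0 u t) - P t) \<le> e)"
    using trig_poly_real_polynomial_on_line[OF P(1)] by blast
qed

section \<open>The regularized two-sided series\<close>

text \<open>
  \<^const>\<open>fourier_coeff\<close> is defined by a choice of limit; for almost periodic functions the limit exists.
\<close>

lemma fourier_coeff_has_mean:
  assumes "almost_periodic (\<lambda>t. complex_of_real (q t))"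
  shows "has_mean (\<lambda>t. complex_of_real (q t) * cis (- (a * t))) (fourier_coeff q a)"
proof -
  have "almost_periodic (\<lambda>t. complex_of_real (q t) * (1 * cis (- a * t)))"
    by (intro almost_periodic_mult assms almost_periodic_trig_poly trig_poly.monomial)
  then obtain m where "\<And>b s. b \<noteq> 0 \<Longrightarrow> has_mean (\<lambda>t. complex_of_real (q (b * t + s)) * cis (- (a * (b * t + s)))) m"
    using almost_periodic_mean by fastforce
  from this[of 1 0] have m: "has_mean (\<lambda>t. complex_of_real (q t) * cis (- (a * t))) m" by simp
  have "fourier_coeff q a = Lim at_top (time_avg (\<lambda>t. complex_of_real (q t) * cis (- (a * t))))"
    by (simp add: fourier_coeff_def time_avg_def[abs_def] cis_conv_exp)
  also have "\<dots> = m"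
    using m by (intro tendsto_Lim) (auto simp: has_mean_def)
  finally show ?thesis using m by simp
qed

lemma has_sum_int_split:
  fixes f :: "int \<Rightarrow> 'a::topological_comm_monoid_add"
  assumes "((\<lambda>n. f (int n)) has_sum A) UNIV" "((\<lambda>n. f (- int (Suc n))) has_sum B) UNIV"
  shows "(f has_sum (A + B)) UNIV"
proof -
  have "(f has_sum A) (range int)"
    using assms(1) by (subst has_sum_reindex) (auto simp: o_def)
  moreover have "(f has_sum B) (range (\<lambda>n. - int (Suc n)))"
    using assms(2) by (subst has_sum_reindex) (auto simp: o_def inj_on_def)
  moreover have "range int \<inter> range (\<lambda>n. - int (Suc n)) = {}" by auto
  ultimately have "(f has_sum (A + B)) (range int \<union> range (\<lambda>n. - int (Suc n)))"
    by (rule has_sum_Un_disjoint)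
  moreover have "range int \<union> range (\<lambda>n. - int (Suc n)) = UNIV"
  proof -
    have "x \<in> range int \<union> range (\<lambda>n. - int (Suc n))" for x
      by (cases x rule: int_cases) auto
    then show ?thesis by blast
  qed
  ultimately show ?thesis by simp
qed

lemma summable_power_Suc: "\<bar>r\<bar> < 1 \<Longrightarrow> summable (\<lambda>n. r ^ Suc n)" for r :: real
  using summable_Suc_iff[of "\<lambda>n. r ^ n"] by simp

text \<open>
  The data of the problem once the torus is forgotten: a bounded almost periodic function \<open>q\<close> with bounded
  continuous derivative, and a ratio \<open>b\<close> with \<open>0 < \<bar>b\<bar> < lam < 1\<close>.
\<close>

locale lacunary_series =
  fixes lam b :: real and q q' :: "real \<Rightarrow> real" and Q Q' :: real
  assumes b_nz: "b \<noteq> 0" and b_less: "\<bar>b\<bar> < lam" and lam_less: "lam < 1"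
    and deriv: "\<And>t. (q has_real_derivative q' t) (at t)"
    and q'_cont: "continuous_on UNIV q'"
    and q_le: "\<And>t. \<bar>q t\<bar> \<le> Q" and q'_le: "\<And>t. \<bar>q' t\<bar> \<le> Q'"
    and ap: "almost_periodic (\<lambda>t. complex_of_real (q t))"
begin

definition u :: "int \<Rightarrow> real \<Rightarrow> real" where
  "u n t = lam powi n * (q (b powi (- n) * t) - q 0)"

text \<open>
  Subtracting \<open>q(0)\<close> in every term of the two-sided series makes the half with \<open>n < 0\<close> converge. Since
  \<open>q(0)\<close> is unchanged by the dilation \<open>t \<mapsto> b t\<close>, the self-similarity of the formal series survives.
\<close>

definition g :: "real \<Rightarrow> real" where
  "g t = (\<Sum>\<^sub>\<infinity>n. u n t)"

definition \<psi> :: "real \<Rightarrow> real" where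
  "\<psi> t = (\<Sum>n. u (- int (Suc n)) t)"

text \<open>
  A summable majorant for the increments of the terms over a distance \<open>h\<close>, uniform in the location: the
  bound on \<open>q\<close> is used for \<open>n \<ge> 0\<close> and the bound on \<open>q'\<close> for \<open>n < 0\<close>.
\<close>

definition M :: "real \<Rightarrow> int \<Rightarrow> real" where
  "M h n = (if n \<ge> 0 then 2 * Q * lam ^ nat n else Q' * h * (\<bar>b\<bar> / lam) ^ nat (- n))"

definition \<alpha> :: real where "\<alpha> = ln lam / ln \<bar>b\<bar>"

lemma lam_pos: "0 < lam" using b_less by linarith

lemma Q_nonneg: "0 \<le> Q" using q_le[of 0] by linarith

lemma Q'_nonneg: "0 \<le> Q'" using q'_le[of 0] by linarith

lemma ratio: "0 < \<bar>b\<bar> / lam" "\<bar>b\<bar> / lam < 1" using b_less lam_pos b_nz by auto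

lemma alpha: "0 < \<alpha>" "\<alpha> < 1"
proof -
  have "ln \<bar>b\<bar> < ln lam" "ln lam < 0"
    using b_less lam_less lam_pos b_nz by auto
  then show "0 < \<alpha>" "\<alpha> < 1" by (auto simp: \<alpha>_def field_simps divide_neg_neg)
qed

lemma q_Lipschitz: "\<bar>q x - q y\<bar> \<le> Q' * \<bar>x - y\<bar>"
proof -
  have "norm (q x - q y) \<le> Q' * norm (x - y)"
    by (rule field_differentiable_bound[of UNIV q q'])
      (use deriv q'_le in auto)
  then show ?thesis by simp
qed

lemma u_0: "u n 0 = 0" by (simp add: u_def)

lemma u_neg: "u (- int (Suc n)) t = (1 / lam) ^ Suc n * (q (b ^ Suc n * t) - q 0)"
  by (simp add: u_def power_int_minus power_one_over inverse_eq_divide del: of_nat_Suc power_Suc)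

lemma u_diff: "u n x - u n y = lam powi n * (q (b powi (- n) * x) - q (b powi (- n) * y))"
  by (simp add: u_def algebra_simps)

lemma abs_u_diff_le:
  assumes "\<bar>x - y\<bar> \<le> h"
  shows "\<bar>u n x - u n y\<bar> \<le> M h n"
proof (cases "n \<ge> 0")
  case True
  have "\<bar>q (b powi (- n) * x) - q (b powi (- n) * y)\<bar> \<le> Q + Q"
    using q_le[of "b powi (- n) * x"] q_le[of "b powi (- n) * y"] by linarith
  then have "\<bar>u n x - u n y\<bar> \<le> lam powi n * (Q + Q)"
    using lam_pos by (simp add: u_diff abs_mult)
  then show ?thesis using True by (simp add: M_def power_int_def mult_ac)
next
  case False
  define k where "k = nat (- n)"
  have n: "n = - int k" using False by (simp add: k_def)
  have "\<bar>q (b ^ k * x) - q (b ^ k * y)\<bar> \<le> Q' * \<bar>b ^ k * x - b ^ k * y\<bar>"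
    by (rule q_Lipschitz)
  also have "\<dots> = Q' * \<bar>b\<bar> ^ k * \<bar>x - y\<bar>"
    by (simp add: abs_mult power_abs flip: right_diff_distrib)
  also have "\<dots> \<le> Q' * \<bar>b\<bar> ^ k * h"
    using assms Q'_nonneg by (intro mult_left_mono) auto
  finally have "\<bar>u n x - u n y\<bar> \<le> lam powi n * (Q' * \<bar>b\<bar> ^ k * h)"
    using lam_pos by (simp add: u_diff abs_mult n)
  also have "\<dots> = M h n"
    using False by (simp add: M_def power_int_minus power_divide n divide_inverse power_mult_distrib power_inverse mult_ac)
  finally show ?thesis .
qed

lemma summable_M_neg: "summable (\<lambda>n. M h (- int (Suc n)))"
proof -
  have "summable (\<lambda>n. Q' * h * (\<bar>b\<bar> / lam) ^ Suc n)"
    using ratio by (intro summable_mult summable_power_Suc) auto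
  then show ?thesis by (simp add: M_def del: power_Suc of_nat_Suc)
qed

lemma summable_M_pos: "summable (\<lambda>n. M h (int n))"
  using lam_less lam_pos by (simp add: M_def summable_geometric)

lemma M_nonneg: "0 \<le> h \<Longrightarrow> 0 \<le> M h n"
  using Q_nonneg Q'_nonneg lam_pos by (simp add: M_def)

lemma M_summable_on:
  assumes "0 \<le> h"
  shows "M h summable_on UNIV"
proof -
  have "((\<lambda>n. M h (int n)) has_sum (\<Sum>n. M h (int n))) UNIV"
    "((\<lambda>n. M h (- int (Suc n))) has_sum (\<Sum>n. M h (- int (Suc n)))) UNIV"
    by (rule sums_nonneg_imp_has_sum[OF summable_sums M_nonneg[OF assms]],
        rule summable_M_pos summable_M_neg)+
  from has_sum_int_split[OF this] show ?thesis by (auto simp: summable_on_def)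
qed

lemma abs_u_le: "\<bar>u n t\<bar> \<le> M \<bar>t\<bar> n"
  using abs_u_diff_le[of t 0 "\<bar>t\<bar>" n] by (simp add: u_0)

lemma u_diff_abs_summable:
  assumes "\<bar>x - y\<bar> \<le> h"
  shows "(\<lambda>n. norm (u n x - u n y)) summable_on UNIV"
proof (rule summable_on_comparison_test)
  show "M h summable_on UNIV" using assms by (intro M_summable_on) linarith
qed (use abs_u_diff_le[OF assms] in auto)

lemma u_has_sum: "((\<lambda>n. u n t) has_sum g t) UNIV"
proof -
  have "(\<lambda>n. norm (u n t - u n 0)) summable_on UNIV"
    by (rule u_diff_abs_summable[OF order_refl])
  then have "(\<lambda>n. u n t) summable_on UNIV"
    unfolding u_0 diff_0_right by (rule abs_summable_summable)
  then show ?thesis unfolding g_def by (rule has_sum_infsum)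
qed

lemma g_diff_has_sum: "((\<lambda>n. u n x - u n y) has_sum (g x - g y)) UNIV"
  using has_sum_add[OF u_has_sum[of x] has_sum_uminusI[OF u_has_sum[of y]]]
  by (simp only: add_uminus_conv_diff)

lemma g_0: "g 0 = 0" by (simp add: g_def u_0)

lemma g_scale: "g (b * t) = lam * g t"
proof -
  have "u n (b * t) = lam * u (n - 1) t" for n
  proof -
    have "lam powi n = lam * lam powi (n - 1)"
      using lam_pos power_int_add_1'[of lam "n - 1"] by simp
    moreover have "b powi (- n) * b = b powi (- (n - 1))"
      using b_nz power_int_add_1[of b "- n"] by (simp add: algebra_simps)
    then have "b powi (- n) * (b * t) = b powi (- (n - 1)) * t" by (metis mult.assoc)
    ultimately show ?thesis unfolding u_def by (simp only: mult.assoc)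
  qed
  then have "g (b * t) = (\<Sum>\<^sub>\<infinity>n. lam * u (n - 1) t)" by (simp add: g_def)
  also have "\<dots> = lam * (\<Sum>\<^sub>\<infinity>n. u (n - 1) t)" by (rule infsum_cmult_right')
  also have "(\<Sum>\<^sub>\<infinity>n. u (n - 1) t) = g t"
    unfolding g_def
    by (rule infsum_reindex_bij_witness[of _ "\<lambda>n. n + 1" "\<lambda>n. n - 1"]) auto
  finally show ?thesis .
qed

lemma g_scale_power: "g (b ^ n * t) = lam ^ n * g t"
  by (induction n) (simp_all add: g_scale mult.assoc)

lemma g_scale_powi: "g (b powi n * t) = lam powi n * g t"
proof (cases "n \<ge> 0")
  case True
  then show ?thesis by (simp add: power_int_def g_scale_power)
next
  case False
  define k where "k = nat (- n)"
  have n: "n = - int k" using False by (simp add: k_def)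
  have "lam ^ k * g (b powi n * t) = g (b ^ k * (b powi n * t))" by (simp add: g_scale_power)
  also have "b ^ k * (b powi n * t) = t" using b_nz by (simp add: n power_int_minus)
  finally show ?thesis using lam_pos by (simp add: n power_int_minus field_simps)
qed

lemma g_bounded_increment:
  obtains K where "0 \<le> K" "\<And>x y. \<bar>x - y\<bar> \<le> 1 \<Longrightarrow> \<bar>g x - g y\<bar> \<le> K"
proof
  show "0 \<le> (\<Sum>\<^sub>\<infinity>n. M 1 n)" by (intro infsum_nonneg M_nonneg) simp
  fix x y :: real assume xy: "\<bar>x - y\<bar> \<le> 1"
  have "((\<lambda>n. u n x - u n y) has_sum (g x - g y)) UNIV"
    by (rule g_diff_has_sum)
  moreover have s: "(\<lambda>n. norm (u n x - u n y)) summable_on UNIV"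
    using xy by (rule u_diff_abs_summable)
  ultimately have "norm (g x - g y) \<le> (\<Sum>\<^sub>\<infinity>n. norm (u n x - u n y))"
    by (intro norm_has_sum_bound[OF has_sum_infsum])
  also have "\<dots> \<le> (\<Sum>\<^sub>\<infinity>n. M 1 n)"
    by (rule infsum_mono[OF s M_summable_on]) (auto intro: abs_u_diff_le xy)
  finally show "\<bar>g x - g y\<bar> \<le> (\<Sum>\<^sub>\<infinity>n. M 1 n)" by simp
qed

text \<open>
  The power of \<open>b\<close> comparable to a given length \<open>h\<close>. Since \<open>\<bar>b\<bar>^\<alpha> = lam\<close>, the corresponding power of \<open>lam\<close> is
  comparable to \<open>h^\<alpha>\<close>, which is how exponents \<open>\<alpha>\<close> arise from self-similarity.
\<close>

lemma scale_between:
  assumes "0 < h"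
  obtains n :: int where "h \<le> \<bar>b\<bar> powi n" "lam powi n \<le> h powr \<alpha> / lam"
    "\<bar>b\<bar> powi (n + 1) < h" "h powr \<alpha> \<le> lam powi n"
proof -
  define x where "x = ln h / ln \<bar>b\<bar>"
  define n where "n = \<lfloor>x\<rfloor>"
  have n: "of_int n \<le> x" "x < of_int n + 1" by (auto simp: n_def)
  have lb: "ln \<bar>b\<bar> < 0" using b_less lam_less b_nz by simp
  have hx: "h = \<bar>b\<bar> powr x" using assms lb b_nz by (simp add: x_def powr_def)
  have hl: "h powr \<alpha> = lam powr x"
    using assms lam_pos lb by (simp add: x_def \<alpha>_def powr_def)
  have b1: "0 < \<bar>b\<bar>" "\<bar>b\<bar> < 1" using b_nz b_less lam_less by auto
  have bp: "\<bar>b\<bar> powi m = \<bar>b\<bar> powr of_int m" for m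
    using b1 by (intro powr_real_of_int'[symmetric]) auto
  have lp: "lam powi m = lam powr of_int m" for m
    using lam_pos by (intro powr_real_of_int'[symmetric]) auto
  show ?thesis
  proof (rule that[of n])
    show "h \<le> \<bar>b\<bar> powi n" unfolding hx bp
      using n b1 by (intro powr_mono') auto
    show "\<bar>b\<bar> powi (n + 1) < h" unfolding hx bp
      using n b1 by (intro powr_less_mono') auto
    show "h powr \<alpha> \<le> lam powi n" unfolding hl lp
      using n lam_pos lam_less by (intro powr_mono') auto
    have "lam powr (n + 1) \<le> lam powr x"
      using n lam_pos lam_less by (intro powr_mono') auto
    then show "lam powi n \<le> h powr \<alpha> / lam" unfolding hl lp
      using lam_pos by (simp add: powr_add field_simps)
  qed
qed

text \<open>
  Dilate a pair of points by a power of \<open>b\<close> until their distance is at most \<open>1\<close> but comparable to \<open>1\<close>, use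
  the bound on increments there, and dilate back.
\<close>

lemma g_Hoelder:
  obtains K where "0 \<le> K" "\<And>x y. \<bar>g x - g y\<bar> \<le> K * \<bar>x - y\<bar> powr \<alpha>"
proof -
  obtain K where K: "0 \<le> K" "\<And>x y. \<bar>x - y\<bar> \<le> 1 \<Longrightarrow> \<bar>g x - g y\<bar> \<le> K"
    using g_bounded_increment by metis
  have "\<bar>g x - g y\<bar> \<le> K / lam * \<bar>x - y\<bar> powr \<alpha>" for x y
  proof (cases "x = y")
    case False
    then have "0 < \<bar>x - y\<bar>" by simp
    then obtain n where n: "\<bar>x - y\<bar> \<le> \<bar>b\<bar> powi n" "lam powi n \<le> \<bar>x - y\<bar> powr \<alpha> / lam"
      by (rule scale_between)
    define c where "c = b powi n"
    have c: "c \<noteq> 0" "\<bar>c\<bar> = \<bar>b\<bar> powi n" using b_nz by (auto simp: c_def power_int_abs)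
    have "\<bar>x / c - y / c\<bar> \<le> 1"
      using n(1) c by (simp add: flip: diff_divide_distrib)
    then have "\<bar>g (x / c) - g (y / c)\<bar> \<le> K" by (rule K(2))
    then have "lam powi n * \<bar>g (x / c) - g (y / c)\<bar> \<le> lam powi n * K"
      using lam_pos by (intro mult_left_mono) auto
    also have "\<dots> \<le> \<bar>x - y\<bar> powr \<alpha> / lam * K" using n(2) K(1) by (rule mult_right_mono)
    finally have "\<bar>lam powi n * g (x / c) - lam powi n * g (y / c)\<bar> \<le> \<bar>x - y\<bar> powr \<alpha> / lam * K"
      using lam_pos by (simp add: abs_mult flip: right_diff_distrib)
    moreover have "lam powi n * g (z / c) = g z" for z
      using g_scale_powi[of n "z / c"] c(1) unfolding c_def[symmetric] by simp
    ultimately show ?thesis by (simp add: mult_ac)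
  qed simp
  then show ?thesis using that[of "K / lam"] K(1) lam_pos by simp
qed

lemma summable_u_neg: "summable (\<lambda>n. u (- int (Suc n)) t)"
  by (rule summable_comparison_test[OF _ summable_M_neg[of "\<bar>t\<bar>"]]) (auto intro: abs_u_le)

lemma g_split: "g t = (\<Sum>n. u (int n) t) + \<psi> t"
proof -
  have "(\<lambda>n. norm (u (int n) t)) summable_on UNIV" "(\<lambda>n. norm (u (- int (Suc n)) t)) summable_on UNIV"
    by (intro norm_summable_imp_summable_on summable_comparison_test[OF _ summable_M_pos[of "\<bar>t\<bar>"]]
          summable_comparison_test[OF _ summable_M_neg[of "\<bar>t\<bar>"]]; force intro: abs_u_le)+
  from this[THEN abs_summable_summable]
  have s: "(\<lambda>n. u (int n) t) summable_on UNIV" "(\<lambda>n. u (- int (Suc n)) t) summable_on UNIV" .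
  have "((\<lambda>n. u n t) has_sum ((\<Sum>\<^sub>\<infinity>n. u (int n) t) + (\<Sum>\<^sub>\<infinity>n. u (- int (Suc n)) t))) UNIV"
    using s by (intro has_sum_int_split has_sum_infsum)
  then have "g t = (\<Sum>\<^sub>\<infinity>n. u (int n) t) + (\<Sum>\<^sub>\<infinity>n. u (- int (Suc n)) t)"
    using u_has_sum by (rule has_sum_unique[rotated])
  moreover have "(\<Sum>\<^sub>\<infinity>n. u (int n) t) = (\<Sum>n. u (int n) t)"
    "(\<Sum>\<^sub>\<infinity>n. u (- int (Suc n)) t) = \<psi> t"
    using s[THEN has_sum_infsum, THEN has_sum_imp_sums] by (auto simp: \<psi>_def sums_iff)
  ultimately show ?thesis by simp
qed

lemma phi_series_eq: "phi_series lam b q t = phi_series lam b q 0 + g t - \<psi> t"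
proof -
  have s: "summable (\<lambda>n. lam ^ n * q (b powi (- int n) * t))" for t
  proof (rule summable_comparison_test)
    show "summable (\<lambda>n. lam ^ n * Q)"
      using lam_pos lam_less by (intro summable_mult2 summable_geometric) auto
    show "\<exists>N. \<forall>n\<ge>N. norm (lam ^ n * q (b powi (- int n) * t)) \<le> lam ^ n * Q"
      using q_le lam_pos by (auto simp: abs_mult)
  qed
  have "phi_series lam b q t - phi_series lam b q 0 = (\<Sum>n. u (int n) t)"
    using suminf_diff[OF s[of t] s[of 0]] by (simp add: phi_series_def u_def right_diff_distrib)
  then show ?thesis using g_split[of t] by simp
qed

lemma psi_Lipschitz:
  obtains L where "0 \<le> L" "\<And>x y. \<bar>\<psi> x - \<psi> y\<bar> \<le> L * \<bar>x - y\<bar>"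
proof
  show "0 \<le> (\<Sum>n. M 1 (- int (Suc n)))"
    by (intro suminf_nonneg summable_M_neg M_nonneg) simp
  fix x y
  have M1: "M \<bar>x - y\<bar> (- int (Suc n)) = M 1 (- int (Suc n)) * \<bar>x - y\<bar>" for n
    by (simp add: M_def)
  have s: "summable (\<lambda>n. norm (u (- int (Suc n)) x - u (- int (Suc n)) y))"
    by (rule summable_comparison_test[OF _ summable_M_neg[of "\<bar>x - y\<bar>"]]) (auto intro: abs_u_diff_le)
  have "norm (\<Sum>n. u (- int (Suc n)) x - u (- int (Suc n)) y)
      \<le> (\<Sum>n. norm (u (- int (Suc n)) x - u (- int (Suc n)) y))"
    by (rule summable_norm[OF s])
  also have "\<dots> \<le> (\<Sum>n. M \<bar>x - y\<bar> (- int (Suc n)))"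
    by (rule suminf_le[OF _ s summable_M_neg]) (simp only: real_norm_def abs_u_diff_le[OF order_refl])
  also have "\<dots> = (\<Sum>n. M 1 (- int (Suc n))) * \<bar>x - y\<bar>"
    unfolding M1 by (rule suminf_mult2[OF summable_M_neg, symmetric])
  finally show "\<bar>\<psi> x - \<psi> y\<bar> \<le> (\<Sum>n. M 1 (- int (Suc n))) * \<bar>x - y\<bar>"
    using suminf_diff[OF summable_u_neg[of x] summable_u_neg[of y]] by (simp add: \<psi>_def)
qed

text \<open>
  Differentiating the \<open>n\<close>-th term produces a factor \<open>b^(n+1)\<close> against \<open>lam^(-(n+1))\<close>, so the series of derivatives
  is dominated by the geometric series of ratio \<open>\<bar>b\<bar> / lam < 1\<close>.
\<close>

lemma psi_C1: "\<psi> C1_differentiable_on UNIV"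
proof -
  define r where "r = b / lam"
  have r: "\<bar>r\<bar> < 1" "\<bar>r\<bar> = \<bar>b\<bar> / lam" using ratio lam_pos by (auto simp: r_def)
  define F' where "F' n t = r ^ Suc n * q' (b ^ Suc n * t)" for n t
  have deriv_u: "(u (- int (Suc n)) has_field_derivative F' n t) (at t)" for n t
  proof -
    have "((\<lambda>t. (1 / lam) ^ Suc n * (q (b ^ Suc n * t) - q 0)) has_field_derivative
        (1 / lam) ^ Suc n * (q' (b ^ Suc n * t) * b ^ Suc n)) (at t)"
      by (rule derivative_eq_intros DERIV_chain2[OF deriv] refl | simp del: power_Suc)+
    moreover have "(1 / lam) ^ Suc n * (q' (b ^ Suc n * t) * b ^ Suc n) = F' n t"
      by (simp add: F'_def r_def power_divide del: power_Suc)
    moreover have "u (- int (Suc n)) = (\<lambda>t. (1 / lam) ^ Suc n * (q (b ^ Suc n * t) - q 0))"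
      by (rule ext) (rule u_neg)
    ultimately show ?thesis by (simp only:)
  qed
  have unif: "uniform_limit UNIV (\<lambda>n t. \<Sum>i<n. F' i t) (\<lambda>t. \<Sum>i. F' i t) sequentially"
  proof (rule Weierstrass_m_test)
    show "norm (F' n t) \<le> \<bar>r\<bar> ^ Suc n * Q'" for n t
      unfolding F'_def norm_mult by (intro mult_mono) (auto simp: power_abs abs_mult q'_le)
    show "summable (\<lambda>n. \<bar>r\<bar> ^ Suc n * Q')"
      using r(1) by (intro summable_mult2 summable_power_Suc) simp
  qed
  obtain G where G: "\<And>t. (\<lambda>n. u (- int (Suc n)) t) sums G t"
    "\<And>t. (G has_field_derivative (\<Sum>i. F' i t)) (at t)"
    using has_field_derivative_series[of UNIV "\<lambda>n. u (- int (Suc n))" F', OF _ _ unif _ summable_u_neg]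
      deriv_u by auto
  have "G = \<psi>" using G(1) by (auto simp: \<psi>_def sums_iff fun_eq_iff)
  then have d: "(\<psi> has_vector_derivative (\<Sum>i. F' i t)) (at t)" for t
    using G(2) by (simp add: has_real_derivative_iff_has_vector_derivative)
  have "continuous_on UNIV (\<lambda>t. \<Sum>i. F' i t)"
  proof (rule uniform_limit_theorem[OF _ unif])
    show "\<forall>\<^sub>F n in sequentially. continuous_on UNIV (\<lambda>t. \<Sum>i<n. F' i t)"
      unfolding F'_def
      by (intro always_eventually allI continuous_intros continuous_on_compose2[OF q'_cont]) auto
  qed simp
  with d show ?thesis unfolding C1_differentiable_on_def
    by (intro exI[of _ "\<lambda>t. \<Sum>i. F' i t"]) simp
qed

lemma almost_periodic_u_diff:
  "almost_periodic (\<lambda>s. complex_of_real (u n (s + t) - u n s))"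
proof -
  have "almost_periodic (\<lambda>s. complex_of_real (lam powi n) *
      (complex_of_real (q (b powi (- n) * s + b powi (- n) * t)) + (- 1) * complex_of_real (q (b powi (- n) * s + 0))))"
    by (intro almost_periodic_cmult almost_periodic_add almost_periodic_affine[OF ap])
  then show ?thesis by (simp add: u_diff algebra_simps)
qed

lemma uniform_limit_g_diff:
  "uniform_limit UNIV (\<lambda>X s. \<Sum>n\<in>X. complex_of_real (u n (s + t) - u n s))
     (\<lambda>s. complex_of_real (g (s + t) - g s)) (finite_subsets_at_top UNIV)"
proof (rule Weierstrass_m_test_general')
  show "norm (complex_of_real (u n (s + t) - u n s)) \<le> M \<bar>t\<bar> n" for n s
    using abs_u_diff_le[of "s + t" s "\<bar>t\<bar>" n] by (simp only: norm_of_real)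
  show "((\<lambda>n. complex_of_real (u n (s + t) - u n s)) has_sum complex_of_real (g (s + t) - g s)) UNIV" for s
    by (intro has_sum_of_real g_diff_has_sum)
qed (simp add: M_summable_on)

lemma almost_periodic_g_diff: "almost_periodic (\<lambda>s. complex_of_real (g (s + t) - g s))"
proof (rule almost_periodic_uniform_limit[OF uniform_limit_g_diff])
  show "almost_periodic (\<lambda>s. \<Sum>n\<in>X. complex_of_real (u n (s + t) - u n s))" for X :: "int set"
  proof (cases "finite X")
    case True
    then show ?thesis by (intro almost_periodic_sum almost_periodic_u_diff)
  qed (simp add: almost_periodic_trig_poly trig_poly_const)
qed simp

text \<open>
  The \<open>n\<close>-th term is \<open>q\<close> dilated by \<open>b^(-n)\<close>, so its coefficient at \<open>a\<close> is that of \<open>q\<close> at \<open>a b^n\<close>; translation by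
  \<open>t\<close> multiplies it by \<open>cis (a t)\<close>.
\<close>

lemma u_diff_mean:
  "has_mean (\<lambda>s. complex_of_real (u n (s + t) - u n s) * cis (- (a * s)))
     ((cis (a * t) - 1) * (complex_of_real (lam powi n) * fourier_coeff q (a * b powi n)))"
proof -
  define \<beta> where "\<beta> = b powi (- n)"
  have \<beta>: "\<beta> \<noteq> 0" "a * b powi n * \<beta> = a"
    using b_nz by (auto simp: \<beta>_def power_int_minus)
  \<comment> \<open>\<open>q\<close> twisted by the frequency that becomes \<open>a\<close> after dilation by \<open>\<beta>\<close>\<close>
  define f where "f y = complex_of_real (q y) * cis (- (a * b powi n * y))" for y
  have "almost_periodic (\<lambda>y. complex_of_real (q y) * (1 * cis (- (a * b powi n) * y)))"
    by (intro almost_periodic_mult ap almost_periodic_trig_poly trig_poly.monomial)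
  then have f: "almost_periodic f" by (simp add: f_def[abs_def])
  have mean: "has_mean (\<lambda>s. f (\<beta> * s + r)) (fourier_coeff q (a * b powi n))" for r
    unfolding f_def[abs_def] using f[unfolded f_def[abs_def]] fourier_coeff_has_mean[OF ap] \<beta>(1)
    by (rule has_mean_affine)
  have c: "continuous_on UNIV (\<lambda>s. f (\<beta> * s + r))" for r
    by (intro continuous_on_almost_periodic almost_periodic_affine f)
  have e: "a * b powi n * (\<beta> * s + \<beta> * r) = a * (s + r)" for s r
    using \<beta>(2) by (metis distrib_left mult.assoc)
  have eq: "complex_of_real (u n (s + t) - u n s) * cis (- (a * s))
      = complex_of_real (lam powi n) * (cis (a * t) * f (\<beta> * s + \<beta> * t) + (- 1) * f (\<beta> * s + \<beta> * 0))" for s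
    unfolding f_def e u_diff \<beta>_def[symmetric]
    by (simp add: algebra_simps cis_mult flip: minus_add_distrib)
  have "has_mean (\<lambda>s. complex_of_real (lam powi n) * (cis (a * t) * f (\<beta> * s + \<beta> * t) + (- 1) * f (\<beta> * s + \<beta> * 0)))
     (complex_of_real (lam powi n) * (cis (a * t) * fourier_coeff q (a * b powi n) + (- 1) * fourier_coeff q (a * b powi n)))"
    by (intro has_mean_cmult has_mean_add mean continuous_intros c)
  then show ?thesis unfolding eq by (simp add: algebra_simps)
qed

text \<open>
  Summation over \<open>n\<close> of the previous identity, legitimate because the majorant \<open>M\<close> makes the series of
  increments converge uniformly in \<open>s\<close>.
\<close>

lemma g_diff_mean:
  "has_mean (\<lambda>s. complex_of_real (g (s + t) - g s) * cis (- (a * s)))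
     ((cis (a * t) - 1) * g_fourier_coeff lam b q a)"
proof -
  define m where "m n = (cis (a * t) - 1) * (complex_of_real (lam powi n) * fourier_coeff q (a * b powi n))" for n
  define f where "f n s = complex_of_real (u n (s + t) - u n s) * cis (- (a * s))" for n s
  have f_le: "norm (f n s) \<le> M \<bar>t\<bar> n" for n s
    using abs_u_diff_le[of "s + t" s "\<bar>t\<bar>" n] unfolding f_def norm_mult norm_of_real by simp
  have f_cont: "continuous_on UNIV (f n)" for n
    unfolding f_def[abs_def]
    by (intro continuous_intros continuous_on_almost_periodic[OF almost_periodic_u_diff] continuous_on_cis)
  have f_mean: "has_mean (f n) (m n)" for n
    unfolding f_def[abs_def] m_def by (rule u_diff_mean)
  have "(\<lambda>n. norm (m n)) summable_on UNIV"
  proof (rule summable_on_comparison_test)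
    show "M \<bar>t\<bar> summable_on UNIV" by (intro M_summable_on) simp
    show "norm (m n) \<le> M \<bar>t\<bar> n" for n by (rule has_mean_norm_le[OF f_cont f_le f_mean])
  qed simp
  then have "(m has_sum (\<Sum>\<^sub>\<infinity>n. m n)) UNIV" by (intro has_sum_infsum) (rule abs_summable_summable)
  also have "(\<Sum>\<^sub>\<infinity>n. m n) = (cis (a * t) - 1) * g_fourier_coeff lam b q a"
    unfolding m_def g_fourier_coeff_def by (rule infsum_cmult_right')
  finally have lim: "(sum m \<longlongrightarrow> (cis (a * t) - 1) * g_fourier_coeff lam b q a) (finite_subsets_at_top UNIV)"
    by (simp add: has_sum_def)
  show ?thesis
  proof (rule has_mean_uniform_limit[OF _ _ _ _ lim])
    show "uniform_limit UNIV (\<lambda>X s. \<Sum>n\<in>X. f n s)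
       (\<lambda>s. complex_of_real (g (s + t) - g s) * cis (- (a * s))) (finite_subsets_at_top UNIV)"
    proof (rule Weierstrass_m_test_general'[OF f_le])
      show "((\<lambda>n. f n s) has_sum complex_of_real (g (s + t) - g s) * cis (- (a * s))) UNIV" for s
        unfolding f_def by (intro has_sum_cmult_left has_sum_of_real g_diff_has_sum)
    qed (simp add: M_summable_on)
    show "continuous_on UNIV (\<lambda>s. \<Sum>n\<in>X. f n s)" for X
      by (intro continuous_on_sum f_cont)
    show "has_mean (\<lambda>s. \<Sum>n\<in>X. f n s) (sum m X)" for X
    proof (cases "finite X")
      case True
      then show ?thesis by (intro has_mean_sum f_cont f_mean)
    next
      case False
      then show ?thesis using has_mean_cmult[OF has_mean_cis[of 0], of 0] by simp
    qed
  qed simp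
qed

lemma g_eq_0_if_coeffs_0:
  assumes "\<And>a. a \<noteq> 0 \<Longrightarrow> g_fourier_coeff lam b q a = 0"
  shows "g t = 0"
proof -
  have "has_mean (\<lambda>s. complex_of_real (g (s + t) - g s) * cis (- (a * s))) 0" for a
    using g_diff_mean[of t a] assms[of a] by (cases "a = 0") auto
  from almost_periodic_uniqueness[OF almost_periodic_g_diff this, of 0]
  show ?thesis by (simp add: g_0)
qed

text \<open>
  If \<open>g\<close> vanished, its increments over the distance \<open>pi / a\<close> would have coefficient \<open>0\<close> at \<open>a\<close>, while
  \<open>cis (a * (pi / a)) - 1 = - 2\<close>.
\<close>

lemma g_nonzero_if_coeff_nonzero:
  assumes "a \<noteq> 0" "g_fourier_coeff lam b q a \<noteq> 0"
  obtains t where "g t \<noteq> 0"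
proof (rule ccontr)
  assume "\<not> thesis"
  then have "g t = 0" for t using that by blast
  then have "has_mean (\<lambda>s. 0) ((cis (a * (pi / a)) - 1) * g_fourier_coeff lam b q a)"
    using g_diff_mean[of "pi / a" a] by simp
  moreover have "has_mean (\<lambda>s. 0) 0"
    using has_mean_cmult[OF has_mean_cis[of 0], of 0] by simp
  ultimately have "(cis (a * (pi / a)) - 1) * g_fourier_coeff lam b q a = 0"
    by (rule has_mean_unique)
  then show False using assms by simp
qed

text \<open>
  A value \<open>g(t) \<noteq> 0\<close> is a nonzero value at the origin of the almost periodic function
  \<open>s \<mapsto> g(s + t) - g(s)\<close>, so such increments recur with bounded gaps. The constant \<open>L\<close> exceeds all shifts
  that occur, increased by the step \<open>\<bar>t\<bar>\<close>.
\<close>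

lemma g_oscillation:
  assumes "g t \<noteq> 0"
  obtains L c where "0 < L" "0 < c"
    "\<forall>s. \<exists>x y. \<bar>x - s\<bar> \<le> L \<and> \<bar>y - s\<bar> \<le> L \<and> c \<le> \<bar>g x - g y\<bar>"
proof -
  have "complex_of_real (g (0 + t) - g 0) \<noteq> 0" using assms by (simp add: g_0)
  then obtain S c where S: "finite S" "0 < c"
    "\<forall>s. \<exists>d\<in>S. c \<le> norm (complex_of_real (g (s + d + t) - g (s + d)))"
    by (rule almost_periodic_syndetic[OF almost_periodic_g_diff])
  define L where "L = (\<Sum>d\<in>S. \<bar>d\<bar>) + \<bar>t\<bar> + 1"
  have L: "\<bar>d\<bar> + \<bar>t\<bar> \<le> L" if "d \<in> S" for d
    using member_le_sum[of d S abs] that S(1) by (simp add: L_def)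
  have "\<exists>x y. \<bar>x - s\<bar> \<le> L \<and> \<bar>y - s\<bar> \<le> L \<and> c \<le> \<bar>g x - g y\<bar>" for s
  proof -
    obtain d where d: "d \<in> S" "c \<le> \<bar>g (s + d + t) - g (s + d)\<bar>"
      using S(3)[rule_format, of s] by (auto simp only: norm_of_real)
    then show ?thesis
      using L[OF d(1)] by (intro exI[of _ "s + d + t"] exI[of _ "s + d"]) auto
  qed
  moreover have "0 < L" unfolding L_def by (intro add_nonneg_pos add_nonneg_nonneg sum_nonneg) auto
  ultimately show ?thesis using that S(2) by blast
qed

text \<open>
  An interval of radius \<open>r\<close> contains the image, under a dilation by a power of \<open>b\<close> comparable to \<open>r\<close>, of an
  interval of the fixed radius \<open>L\<close> from \<open>g_oscillation\<close>.
\<close>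

lemma g_oscillation_scaled:
  assumes "g t \<noteq> 0"
  obtains c where "0 < c"
    "\<forall>r>0. \<forall>s. \<exists>x y. \<bar>x - s\<bar> \<le> r \<and> \<bar>y - s\<bar> \<le> r \<and> c * r powr \<alpha> \<le> \<bar>g x - g y\<bar>"
proof -
  obtain L c where L: "0 < L" and c: "0 < c"
    and osc: "\<forall>s. \<exists>x y. \<bar>x - s\<bar> \<le> L \<and> \<bar>y - s\<bar> \<le> L \<and> c \<le> \<bar>g x - g y\<bar>"
    by (rule g_oscillation[OF assms])
  have "\<exists>x y. \<bar>x - s\<bar> \<le> r \<and> \<bar>y - s\<bar> \<le> r \<and> c * lam / L powr \<alpha> * r powr \<alpha> \<le> \<bar>g x - g y\<bar>"
    if r: "0 < r" for r s
  proof -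
    obtain n where n: "\<bar>b\<bar> powi (n + 1) < r / L" "(r / L) powr \<alpha> \<le> lam powi n"
      using scale_between[of "r / L"] r L by (metis divide_pos_pos)
    define k where "k = b powi (n + 1)"
    have k: "k \<noteq> 0" "\<bar>k\<bar> * L \<le> r"
      using b_nz n(1) L by (auto simp: k_def power_int_abs field_simps)
    obtain x y where xy: "\<bar>x - s / k\<bar> \<le> L" "\<bar>y - s / k\<bar> \<le> L" "c \<le> \<bar>g x - g y\<bar>"
      using osc by blast
    have near: "\<bar>k * z - s\<bar> \<le> r" if "\<bar>z - s / k\<bar> \<le> L" for z
    proof -
      have "k * z - s = k * (z - s / k)" using k(1) by (simp add: right_diff_distrib)
      then have "\<bar>k * z - s\<bar> \<le> \<bar>k\<bar> * L" using that by (simp add: abs_mult mult_left_mono)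
      then show ?thesis using k(2) by linarith
    qed
    have "c * lam / L powr \<alpha> * r powr \<alpha> = lam * (r / L) powr \<alpha> * c"
      using r L by (simp add: powr_divide)
    also have "\<dots> \<le> lam * lam powi n * \<bar>g x - g y\<bar>"
      using n(2) xy(3) lam_pos c by (intro mult_mono) auto
    also have "lam * lam powi n = lam powi (n + 1)" using lam_pos by (simp add: power_int_add_1')
    also have "lam powi (n + 1) * \<bar>g x - g y\<bar> = \<bar>g (k * x) - g (k * y)\<bar>"
      using lam_pos by (simp add: k_def g_scale_powi abs_mult flip: right_diff_distrib)
    finally show ?thesis using near xy by blast
  qed
  moreover have "0 < c * lam / L powr \<alpha>" using c lam_pos L by simp
  ultimately show ?thesis using that by blast
qed

theorem phi_smooth_if_coeffs_0:
  assumes "\<And>a. a \<noteq> 0 \<Longrightarrow> g_fourier_coeff lam b q a = 0" and "0 < \<delta>"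
  shows "phi_series lam b q C1_differentiable_on UNIV"
    and "has_box_dim (graph_on {-\<delta>..\<delta>} (phi_series lam b q)) 1"
proof -
  have phi: "phi_series lam b q = (\<lambda>t. phi_series lam b q 0 - \<psi> t)"
  proof
    show "phi_series lam b q t = phi_series lam b q 0 - \<psi> t" for t
      using g_eq_0_if_coeffs_0[OF assms(1), of t] phi_series_eq[of t] by simp
  qed
  show "phi_series lam b q C1_differentiable_on UNIV"
    by (subst phi) (intro C1_differentiable_on_diff C1_differentiable_on_const psi_C1)
  obtain L where L: "0 \<le> L" "\<And>x y. \<bar>\<psi> x - \<psi> y\<bar> \<le> L * \<bar>x - y\<bar>"
    using psi_Lipschitz by metis
  show "has_box_dim (graph_on {-\<delta>..\<delta>} (phi_series lam b q)) 1"
  proof (rule has_box_dim_graph_Lipschitz[OF assms(2) L(1)])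
    show "\<bar>phi_series lam b q x - phi_series lam b q y\<bar> \<le> L * \<bar>x - y\<bar>" for x y
      unfolding phi_series_eq[of x] phi_series_eq[of y]
      using L(2)[of x y] g_eq_0_if_coeffs_0[OF assms(1)] by simp
  qed
qed

text \<open>
  \<open>g\<close> provides the exact Hoelder behaviour at scale \<open>r\<close>, and \<open>\<psi>\<close> perturbs it by \<open>O(r) = o(r^\<alpha>)\<close>.
\<close>

theorem phi_fractal_if_coeff_nonzero:
  assumes "a \<noteq> 0" "g_fourier_coeff lam b q a \<noteq> 0" and \<delta>: "0 < \<delta>"
  shows "has_box_dim (graph_on {-\<delta>..\<delta>} (phi_series lam b q)) (2 - \<alpha>)"
proof -
  let ?\<phi> = "phi_series lam b q"
  obtain t where "g t \<noteq> 0" using g_nonzero_if_coeff_nonzero[OF assms(1,2)] .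
  then obtain c where c: "0 < c"
    and osc: "\<forall>r>0. \<forall>s. \<exists>x y. \<bar>x - s\<bar> \<le> r \<and> \<bar>y - s\<bar> \<le> r \<and> c * r powr \<alpha> \<le> \<bar>g x - g y\<bar>"
    by (rule g_oscillation_scaled)
  obtain L where L: "0 \<le> L" "\<And>x y. \<bar>\<psi> x - \<psi> y\<bar> \<le> L * \<bar>x - y\<bar>"
    using psi_Lipschitz by metis
  obtain K where K: "0 \<le> K" "\<And>x y. \<bar>g x - g y\<bar> \<le> K * \<bar>x - y\<bar> powr \<alpha>"
    using g_Hoelder by metis
  have phi_diff: "?\<phi> x - ?\<phi> y = (g x - g y) - (\<psi> x - \<psi> y)" for x y
    unfolding phi_series_eq[of x] phi_series_eq[of y] by simp
  show ?thesis
  proof (rule has_box_dim_graph_exact_Hoelder[OF \<delta>])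
    show "0 \<le> K + L * (2 * \<delta>) powr (1 - \<alpha>)" using K(1) L(1) by simp
    show "0 < c / 2" using c by simp
    show "\<alpha> \<le> 1" using alpha by simp
    show "\<bar>?\<phi> x - ?\<phi> y\<bar> \<le> (K + L * (2 * \<delta>) powr (1 - \<alpha>)) * \<bar>x - y\<bar> powr \<alpha>"
      if "x \<in> {-\<delta>..\<delta>}" "y \<in> {-\<delta>..\<delta>}" for x y
    proof -
      have "\<bar>x - y\<bar> = \<bar>x - y\<bar> powr (1 - \<alpha>) * \<bar>x - y\<bar> powr \<alpha>"
        by (simp flip: powr_add)
      also have "\<dots> \<le> (2 * \<delta>) powr (1 - \<alpha>) * \<bar>x - y\<bar> powr \<alpha>"
        using that alpha by (intro mult_right_mono powr_mono2) auto
      finally have "L * \<bar>x - y\<bar> \<le> L * ((2 * \<delta>) powr (1 - \<alpha>) * \<bar>x - y\<bar> powr \<alpha>)"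
        using L(1) by (rule mult_left_mono)
      then show ?thesis
        using K(2)[of x y] L(2)[of x y] unfolding phi_diff by (simp add: algebra_simps)
    qed
    have "((\<lambda>r. 2 * L * r powr (1 - \<alpha>)) \<longlongrightarrow> 2 * L * 0 powr (1 - \<alpha>)) (at_right 0)"
      using alpha by (intro tendsto_intros) (auto simp: eventually_at_right_field intro!: exI[of _ 1])
    from order_tendstoD(2)[OF this, of "c / 2"]
    have "\<forall>\<^sub>F r in at_right 0. 2 * L * r powr (1 - \<alpha>) < c / 2"
      using c by simp
    moreover have "\<forall>\<^sub>F r in at_right 0. (0::real) < r" by (rule eventually_at_right_less)
    ultimately show "\<forall>\<^sub>F r in at_right 0. \<forall>s. \<exists>x y. \<bar>x - s\<bar> \<le> r \<and> \<bar>y - s\<bar> \<le> r \<and> c / 2 * r powr \<alpha> \<le> \<bar>?\<phi> x - ?\<phi> y\<bar>"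
    proof eventually_elim
      case (elim r)
      show ?case
      proof
        fix s
        obtain x y where xy: "\<bar>x - s\<bar> \<le> r" "\<bar>y - s\<bar> \<le> r" "c * r powr \<alpha> \<le> \<bar>g x - g y\<bar>"
          using osc elim(2) by blast
        have "\<bar>\<psi> x - \<psi> y\<bar> \<le> L * (2 * r)"
          using L(2)[of x y] mult_left_mono[OF _ L(1), of "\<bar>x - y\<bar>" "2 * r"] xy(1,2) by linarith
        also have "\<dots> = 2 * L * r powr (1 - \<alpha>) * r powr \<alpha>"
          using elim(2) by (simp add: mult.assoc flip: powr_add)
        also have "\<dots> \<le> c / 2 * r powr \<alpha>"
          using elim(1) by (intro mult_right_mono) auto
        finally have "c / 2 * r powr \<alpha> \<le> \<bar>?\<phi> x - ?\<phi> y\<bar>"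
          using xy(3) unfolding phi_diff by linarith
        then show "\<exists>x y. \<bar>x - s\<bar> \<le> r \<and> \<bar>y - s\<bar> \<le> r \<and> c / 2 * r powr \<alpha> \<le> \<bar>?\<phi> x - ?\<phi> y\<bar>"
          using xy(1,2) by blast
      qed
    qed
  qed (rule alpha)
qed

end

section \<open>The dichotomy\<close>

text \<open>
  The derivatives of \<open>p\<close> and the periodicity of \<open>p\<close> enter the argument only through this reduction to a
  function of one variable.
\<close>

lemma lacunary_series_line_fun:
  fixes p :: "real^'k \<Rightarrow> real"
  assumes "torus_fun p" "Ck_fun (Suc m) p" "b \<noteq> 0" "\<bar>b\<bar> < lam" "lam < 1"
  obtains q' Q Q' where "lacunary_series lam b (line_fun p x0 u) q' Q Q'"
proof -
  have p: "continuous_on UNIV p" using assms(2) by (rule Ck_fun_continuous)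
  obtain Q where Q: "\<And>x. \<bar>p x\<bar> \<le> Q" using torus_fun_bounded[OF assms(1) p] by blast
  obtain q' Q' where q': "\<And>t. (line_fun p x0 u has_real_derivative q' t) (at t)"
    "continuous_on UNIV q'" "\<And>t. \<bar>q' t\<bar> \<le> Q'"
    using line_fun_derivative[OF assms(1,2)] by blast
  have "lacunary_series lam b (line_fun p x0 u) q' Q Q'"
    using assms q' Q almost_periodic_line_fun[OF assms(1) p]
    by unfold_locales (auto simp: line_fun_def)
  then show ?thesis by (rule that)
qed

lemma eigenvalue_nonzero:
  fixes A :: "real^'k^'k"
  assumes "det A \<noteq> 0" "v \<noteq> 0" "A *v v = b *s v"
  shows "b \<noteq> 0"
proof
  assume "b = 0"
  then have "A *v v = 0" using assms(3) by simp
  moreover have "invertible A" using assms(1) by (simp add: invertible_det_nz)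
  ultimately show False
    using assms(2) by (metis invertible_def matrix_vector_mul_assoc matrix_vector_mul_lid matrix_vector_mult_0_right)
qed

theorem theorem3p4:
  fixes A :: "real^'k^'k"
    and B :: "nat \<Rightarrow> real"
    and v :: "nat \<Rightarrow> real^'k"
    and p :: "real^'k \<Rightarrow> real"
    and x0 :: "real^'k"
    and lam \<delta> :: real
    and i j :: nat
  defines "q \<equiv> line_fun p x0 (v i)"
  defines "\<phi> \<equiv> phi_series lam (B i) q"
  assumes "CARD('k) > 2"
    and "anosov_automorphism A"
    and "real_eigendata A j B v"
    and "0 < lam" and "lam < 1"
    and "0 < \<delta>"
    and "torus_fun p" and "Ck_fun (CARD('k) + 1) p"
    and "1 \<le> i" and "i \<le> j" and "\<bar>B i\<bar> < lam"
  shows "((\<forall>\<sigma>. \<sigma> \<noteq> 0 \<longrightarrow> g_fourier_coeff lam (B i) q \<sigma> = 0) \<and>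
           \<phi> C1_differentiable_on UNIV \<and>
           has_box_dim (graph_on {-\<delta>..\<delta>} \<phi>) 1)
       \<or> ((\<exists>\<sigma>. \<sigma> \<noteq> 0 \<and> g_fourier_coeff lam (B i) q \<sigma> \<noteq> 0) \<and>
           has_box_dim (graph_on {-\<delta>..\<delta>} \<phi>) (2 - ln lam / ln \<bar>B i\<bar>))"
proof -
  have "i \<in> {1..CARD('k)}"
    using assms(5,11,12) by (simp add: real_eigendata_def)
  then have "v i \<noteq> 0" "A *v v i = B i *s v i"
    using assms(5) by (auto simp: real_eigendata_def)
  have "det A \<noteq> 0"
    using assms(4) by (auto simp: anosov_automorphism_def)
  from this \<open>v i \<noteq> 0\<close> \<open>A *v v i = B i *s v i\<close>
  have "B i \<noteq> 0" by (rule eigenvalue_nonzero)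
  have "Ck_fun (Suc CARD('k)) p" using assms(10) by (simp only: Suc_eq_plus1)
  then obtain q' Q Q' where "lacunary_series lam (B i) q q' Q Q'"
    unfolding q_def
    by (rule lacunary_series_line_fun[OF assms(9) _ \<open>B i \<noteq> 0\<close> assms(13,7)])
  then interpret lacunary_series lam "B i" q q' Q Q' .
  show ?thesis
  proof (cases "\<forall>\<sigma>. \<sigma> \<noteq> 0 \<longrightarrow> g_fourier_coeff lam (B i) q \<sigma> = 0")
    case True
    then show ?thesis
      using phi_smooth_if_coeffs_0[OF _ assms(8)] unfolding \<phi>_def by simp
  next
    case False
    then obtain \<sigma> where "\<sigma> \<noteq> 0" "g_fourier_coeff lam (B i) q \<sigma> \<noteq> 0" by auto
    then show ?thesis
      using phi_fractal_if_coeff_nonzero[OF _ _ assms(8)] unfolding \<phi>_def \<alpha>_def by auto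
  qed
qed

end
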